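(* Let $\theta\in\mathbb R\setminus\pi\mathbb Z$, let $\phi\in L^2(\mathbb R)$ be well-defined everywhere on $\mathbb R$, and assume $C_{\phi,\theta}(t)<\infty$ for all $t\in\mathbb R$. (a) If $\{\eta_\theta(t)\vec\phi(t-n):n\in\mathbb Z\}$ is a frame of $V_\theta(\phi)$, then $V_\theta^p(\phi):=\{(\mathbf c\ast_\theta\phi)(t):\mathbf c\in N(T_\theta)^\perp\}$ is a reproducing kernel Hilbert space in which any $f(t)=(\mathbf c\ast_\theta\phi)(t)$ is the pointwise limit of $\eta_\theta(t)\sum_{n\in\mathbb Z}\vec c(n)\vec\phi(t-n)$, which converges also in $L^2(\mathbb R)$. Here $N(T_\theta)^\perp$ denotes the orthogonal complement of $N(T_\theta):=\mathrm{Ker}(T_\theta)$ in $\ell^2(\mathbb Z)$. (b) If $\{\eta_\theta(t)\vec\phi(t-n):n\in\mathbb Z\}$ is a Riesz basis of $V_\theta(\phi)$, then $V_\theta(\phi)$ is a reproducing kernel Hilbert space in which any $f(t)=(\mathbf c\ast_\theta\phi)(t)$ is the pointwise limit of $\eta_\theta(t)\sum_{n\in\mathbb Z}\vec c(n)\vec\phi(t-n)$, which converges also in $L^2(\mathbb R)$. (c) If $\{\eta_\theta(t)\vec\phi(t-n):n\in\mathbb Z\}$ is a frame of $V_\theta(\phi)$, $\vec\phi(t)$ is continuous on $\mathbb R$ and $\sup_{t\in\mathbb R}C_{\phi,\theta}(t)<\infty$, then $V_\theta(\phi)$ is a reproducing kernel Hilbert space in which any $f(t)=(\mathbf c\ast_\theta\phi)(t)$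 is the pointwise limit of $\eta_\theta(t)\sum_{n\in\mathbb Z}\vec c(n)\vec\phi(t-n)$, which converges also in $L^2(\mathbb R)$ and uniformly on $\mathbb R$ to a continuous function on $\mathbb R$ (so $V_\theta(\phi)\subset C(\mathbb R)\cap L^2(\mathbb R)$).
   Context: Notation, for $\theta\in\mathbb R\setminus\pi\mathbb Z$: $c(\theta)=\sqrt{\frac{1-i\cot\theta}{2\pi}}$, $a=\frac{\cot\theta}{2}$, $\lambda_\theta(x)=e^{iax^2}$, $\eta_\theta(t)=c(\theta)\overline{\lambda_\theta(t)}$. The chirp-modulated version of a function $f$ is $\vec f(t)=\lambda_\theta(t)f(t)$, and of a sequence $\mathbf c=\{c(n)\}_n$ is $\vec c(n)=\lambda_\theta(n)c(n)$. For $\phi\in L^2(\mathbb R)$: $C_{\phi,\theta}(t)=\sum_{n\in\mathbb Z}|\vec\phi(t-n)|^2$. Fractional semi-discrete convolution: $T_\theta(\mathbf c)(t)=(\mathbf c\ast_\theta\phi)(t)=\eta_\theta(t)\sum_{n\in\mathbb Z}\vec c(n)\vec\phi(t-n)$, $\mathbf c\in\ell^2(\mathbb Z)$; the kernel of $T_\theta$ is that of $T_\theta$ as an operator from $\ell^2(\mathbb Z)$ into $L^2(\mathbb R)$ (well-defined and bounded when $\{\eta_\theta(t)\vec\phi(t-n)\}_n$ is a frame of its closed span). The chirp-modulated shift-invariant space generated by $\phi$ is $V_\theta(\phi)=\overline{\mathrm{span}}\{\eta_\theta(t)\vec\phi(t-n):n\in\mathbb Z\}\subset L^2(\mathbb R)$.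 All these spaces carry the $L^2(\mathbb R)$ inner product. A Hilbert space $\mathcal H$ of complex-valued functions on a set $E$ is a reproducing kernel Hilbert space if there is a function $q(s,t)$ on $E\times E$ with $q(\cdot,t)\in\mathcal H$ for each $t\in E$ and $\langle f(\cdot),q(\cdot,t)\rangle=f(t)$ for all $f\in\mathcal H$, $t\in E$. Here $E=\mathbb R$ and elements are regarded as everywhere-defined functions through the pointwise sums. A sequence $\{\phi_n\}_{n\in\mathbb Z}$ in a separable Hilbert space $\mathcal H$ is a frame of $\mathcal H$ if there are $B\ge A>0$ with $A\|h\|^2\le\sum_n|\langle h,\phi_n\rangle|^2\le B\|h\|^2$ for all $h\in\mathcal H$; it is a Riesz basis of $\mathcal H$ if it is complete in $\mathcal H$ and there are $B\ge A>0$ with $A\|\mathbf c\|^2\le\|\sum_nc(n)\phi_n\|^2\le B\|\mathbf c\|^2$ for all $\mathbf c\in\ell^2(\mathbb Z)$. *)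

theory Defs
  imports "HOL-Analysis.Analysis"
begin

section \<open>The spaces \<open>L\<^sup>2(\<real>)\<close> and \<open>\<ell>\<^sup>2(\<int>)\<close>\<close>

text \<open>Elements of \<open>L\<^sup>2(\<real>)\<close> are represented by everywhere-defined functions; equality of classes is
  equality almost everywhere and is always written out.\<close>

definition L2 :: "(real \<Rightarrow> complex) set" where
  "L2 = {f. f \<in> borel_measurable lebesgue \<and> integrable lebesgue (\<lambda>t. (cmod (f t))\<^sup>2)}"

definition L2_inner :: "(real \<Rightarrow> complex) \<Rightarrow> (real \<Rightarrow> complex) \<Rightarrow> complex" where
  "L2_inner f g = (LINT t|lebesgue. f t * cnj (g t))"

definition L2_norm :: "(real \<Rightarrow> complex) \<Rightarrow> real" where
  "L2_norm f = sqrt (LINT t|lebesgue. (cmod (f t))\<^sup>2)"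

text \<open>Unconditional convergence of a series in \<open>L\<^sup>2(\<real>)\<close>. The membership conditions matter because the
  Bochner integral of a non-integrable function is \<open>0\<close>.\<close>

definition L2_has_sum :: "('i \<Rightarrow> real \<Rightarrow> complex) \<Rightarrow> (real \<Rightarrow> complex) \<Rightarrow> bool" where
  "L2_has_sum g f \<longleftrightarrow> (\<forall>n. g n \<in> L2) \<and> f \<in> L2 \<and>
     ((\<lambda>F. L2_norm (\<lambda>t. (\<Sum>n\<in>F. g n t) - f t)) \<longlongrightarrow> 0) (finite_subsets_at_top UNIV)"

text \<open>As a set of functions, the closed span contains every representative of each of its classes.\<close>

definition L2_closed_span :: "('i \<Rightarrow> real \<Rightarrow> complex) \<Rightarrow> (real \<Rightarrow> complex) set" where
  "L2_closed_span g = {f \<in> L2. \<forall>e>0. \<exists>F a. finite F \<and> L2_norm (\<lambda>t. f t - (\<Sum>n\<in>F. a n * g n t)) < e}"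

definition ell2 :: "(int \<Rightarrow> complex) set" where
  "ell2 = {c. (\<lambda>n. (cmod (c n))\<^sup>2) summable_on UNIV}"

definition ell2_inner :: "(int \<Rightarrow> complex) \<Rightarrow> (int \<Rightarrow> complex) \<Rightarrow> complex" where
  "ell2_inner c d = (\<Sum>\<^sub>\<infinity>n. c n * cnj (d n))"

definition ell2_norm :: "(int \<Rightarrow> complex) \<Rightarrow> real" where
  "ell2_norm c = sqrt (\<Sum>\<^sub>\<infinity>n. (cmod (c n))\<^sup>2)"

definition ell2_orthogonal :: "(int \<Rightarrow> complex) set \<Rightarrow> (int \<Rightarrow> complex) set" where
  "ell2_orthogonal N = {c \<in> ell2. \<forall>d\<in>N. ell2_inner c d = 0}"


section \<open>Frames and Riesz bases of subspaces of \<open>L\<^sup>2(\<real>)\<close>\<close>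

definition is_frame :: "(int \<Rightarrow> real \<Rightarrow> complex) \<Rightarrow> (real \<Rightarrow> complex) set \<Rightarrow> bool" where
  "is_frame g H \<longleftrightarrow> (\<forall>n. g n \<in> H) \<and>
     (\<exists>A B. 0 < A \<and> A \<le> B \<and>
       (\<forall>h\<in>H. (\<lambda>n. (cmod (L2_inner h (g n)))\<^sup>2) summable_on UNIV \<and>
          A * (L2_norm h)\<^sup>2 \<le> (\<Sum>\<^sub>\<infinity>n. (cmod (L2_inner h (g n)))\<^sup>2) \<and>
          (\<Sum>\<^sub>\<infinity>n. (cmod (L2_inner h (g n)))\<^sup>2) \<le> B * (L2_norm h)\<^sup>2))"

definition is_Riesz_basis :: "(int \<Rightarrow> real \<Rightarrow> complex) \<Rightarrow> (real \<Rightarrow> complex) set \<Rightarrow> bool" where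
  "is_Riesz_basis g H \<longleftrightarrow> (\<forall>n. g n \<in> H) \<and> H \<subseteq> L2_closed_span g \<and>
     (\<exists>A B. 0 < A \<and> A \<le> B \<and>
       (\<forall>c\<in>ell2. \<exists>f. L2_has_sum (\<lambda>n t. c n * g n t) f \<and>
          A * (ell2_norm c)\<^sup>2 \<le> (L2_norm f)\<^sup>2 \<and> (L2_norm f)\<^sup>2 \<le> B * (ell2_norm c)\<^sup>2))"


section \<open>Reproducing kernel Hilbert spaces\<close>

text \<open>The elements are genuine functions: \<open>definite\<close> demands vanishing at every point. The set on
  which the functions live is the type \<open>'e\<close>.\<close>

locale function_Hilbert_space =
  fixes H :: "('e \<Rightarrow> complex) set"
    and ip :: "('e \<Rightarrow> complex) \<Rightarrow> ('e \<Rightarrow> complex) \<Rightarrow> complex"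
  assumes zero: "(\<lambda>x. 0) \<in> H"
    and add: "f \<in> H \<Longrightarrow> g \<in> H \<Longrightarrow> (\<lambda>x. f x + g x) \<in> H"
    and scale: "f \<in> H \<Longrightarrow> (\<lambda>x. a * f x) \<in> H"
    and ip_add: "f \<in> H \<Longrightarrow> g \<in> H \<Longrightarrow> h \<in> H \<Longrightarrow> ip (\<lambda>x. f x + g x) h = ip f h + ip g h"
    and ip_scale: "f \<in> H \<Longrightarrow> g \<in> H \<Longrightarrow> ip (\<lambda>x. a * f x) g = a * ip f g"
    and ip_commute: "f \<in> H \<Longrightarrow> g \<in> H \<Longrightarrow> ip g f = cnj (ip f g)"
    and ip_nonneg: "f \<in> H \<Longrightarrow> 0 \<le> Re (ip f f)"
    and definite: "f \<in> H \<Longrightarrow> ip f f = 0 \<Longrightarrow> f = (\<lambda>x. 0)"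
    and complete:
      "(\<And>n. s n \<in> H) \<Longrightarrow>
       (\<forall>e>0. \<exists>N::nat. \<forall>m\<ge>N. \<forall>n\<ge>N. sqrt (Re (ip (\<lambda>x. s m x - s n x) (\<lambda>x. s m x - s n x))) < e) \<Longrightarrow>
       \<exists>f\<in>H. (\<lambda>n. sqrt (Re (ip (\<lambda>x. s n x - f x) (\<lambda>x. s n x - f x)))) \<longlonglongrightarrow> 0"

locale reproducing_kernel_Hilbert_space = function_Hilbert_space +
  assumes reproducing_kernel:
    "\<exists>q. (\<forall>t. (\<lambda>s. q s t) \<in> H) \<and> (\<forall>f\<in>H. \<forall>t. ip f (\<lambda>s. q s t) = f t)"


section \<open>Chirp-modulated shift-invariant spaces\<close>

definition chirp_const :: "real \<Rightarrow> complex" where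
  "chirp_const \<theta> = csqrt ((1 - \<i> * complex_of_real (cot \<theta>)) / complex_of_real (2 * pi))"

definition chirp :: "real \<Rightarrow> real \<Rightarrow> complex" where
  "chirp \<theta> x = exp (\<i> * complex_of_real (cot \<theta> / 2 * x\<^sup>2))"

definition chirp_eta :: "real \<Rightarrow> real \<Rightarrow> complex" where
  "chirp_eta \<theta> t = chirp_const \<theta> * cnj (chirp \<theta> t)"

definition chirp_fun :: "real \<Rightarrow> (real \<Rightarrow> complex) \<Rightarrow> real \<Rightarrow> complex" where
  "chirp_fun \<theta> f t = chirp \<theta> t * f t"

definition chirp_seq :: "real \<Rightarrow> (int \<Rightarrow> complex) \<Rightarrow> int \<Rightarrow> complex" where
  "chirp_seq \<theta> c n = chirp \<theta> (of_int n) * c n"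

definition C_sum :: "real \<Rightarrow> (real \<Rightarrow> complex) \<Rightarrow> real \<Rightarrow> ennreal" where
  "C_sum \<theta> \<phi> t = (\<Sum>\<^sub>\<infinity>n::int. ennreal ((cmod (chirp_fun \<theta> \<phi> (t - of_int n)))\<^sup>2))"

definition shift_gen :: "real \<Rightarrow> (real \<Rightarrow> complex) \<Rightarrow> int \<Rightarrow> real \<Rightarrow> complex" where
  "shift_gen \<theta> \<phi> n t = chirp_eta \<theta> t * chirp_fun \<theta> \<phi> (t - of_int n)"

definition V_space :: "real \<Rightarrow> (real \<Rightarrow> complex) \<Rightarrow> (real \<Rightarrow> complex) set" where
  "V_space \<theta> \<phi> = L2_closed_span (shift_gen \<theta> \<phi>)"

definition frac_conv :: "real \<Rightarrow> (real \<Rightarrow> complex) \<Rightarrow> (int \<Rightarrow> complex) \<Rightarrow> real \<Rightarrow> complex" where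
  "frac_conv \<theta> \<phi> c t =
     chirp_eta \<theta> t * (\<Sum>\<^sub>\<infinity>n::int. chirp_seq \<theta> c n * chirp_fun \<theta> \<phi> (t - of_int n))"

definition frac_conv_term ::
    "real \<Rightarrow> (real \<Rightarrow> complex) \<Rightarrow> (int \<Rightarrow> complex) \<Rightarrow> int \<Rightarrow> real \<Rightarrow> complex" where
  "frac_conv_term \<theta> \<phi> c n t =
     chirp_eta \<theta> t * (chirp_seq \<theta> c n * chirp_fun \<theta> \<phi> (t - of_int n))"

text \<open>The operator takes values in \<open>L\<^sup>2(\<real>)\<close>, so its kernel is defined by vanishing almost everywhere.\<close>

definition T_kernel :: "real \<Rightarrow> (real \<Rightarrow> complex) \<Rightarrow> (int \<Rightarrow> complex) set" where
  "T_kernel \<theta> \<phi> = {c \<in> ell2. AE t in lebesgue. frac_conv \<theta> \<phi> c t = 0}"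

definition Vp_space :: "real \<Rightarrow> (real \<Rightarrow> complex) \<Rightarrow> (real \<Rightarrow> complex) set" where
  "Vp_space \<theta> \<phi> = frac_conv \<theta> \<phi> ` ell2_orthogonal (T_kernel \<theta> \<phi>)"

text \<open>Elements of \<open>V_space\<close> regarded as everywhere-defined functions: those representatives that are
  given at every point by the pointwise sum.\<close>

definition V_pointwise :: "real \<Rightarrow> (real \<Rightarrow> complex) \<Rightarrow> (real \<Rightarrow> complex) set" where
  "V_pointwise \<theta> \<phi> = frac_conv \<theta> \<phi> ` ell2"

text \<open>\<open>W\<close> contains exactly one representative of every almost-everywhere class in \<open>V\<close>, and nothing
  else. This is what it means for \<open>V\<close>, a set of classes, to be a space of functions via \<open>W\<close>.\<close>

definition represents_classes :: "(real \<Rightarrow> complex) set \<Rightarrow> (real \<Rightarrow> complex) set \<Rightarrow> bool" where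
  "represents_classes W V \<longleftrightarrow>
     W \<subseteq> V \<and> (\<forall>f\<in>V. \<exists>!g. g \<in> W \<and> (AE t in lebesgue. f t = g t))"

end

theory Submission
  imports Defs
begin

text \<open>Absorbing the chirp \<open>\<lambda>\<^sub>\<theta>(n)\<close> into the generators, put
\<open>g\<^sub>n(t) = \<lambda>\<^sub>\<theta>(n) \<eta>\<^sub>\<theta>(t) \<phi>(t - n) \<lambda>\<^sub>\<theta>(t - n)\<close>. Then \<open>T\<^sub>\<theta>\<close> is the synthesis operator
\<open>S c = \<Sum> c(n) g\<^sub>n\<close>, and since the \<open>g\<^sub>n\<close> are unimodular multiples of the generators of \<open>V\<^sub>\<theta>(\<phi>)\<close>, they
have the same closed span and the same frame bounds. Finiteness of \<open>C\<close> says
that \<open>(g\<^sub>n(t))\<^sub>n\<close> is square-summable for each \<open>t\<close>, so the series for \<open>S c\<close> converges absolutely at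
each point and \<open>|S c(t)| \<le> \<parallel>c\<parallel> \<parallel>(g\<^sub>n(t))\<^sub>n\<parallel>\<close>.

Everything is deduced for a frame \<open>(g\<^sub>n)\<close> of its closed span \<open>V\<close> with this pointwise property
(locale \<open>pointwise_frame\<close>). The upper frame bound \<open>B\<close> bounds the norm of finite sums
\<open>\<Sum> a(n) g\<^sub>n\<close> by \<open>\<surd>B \<parallel>a\<parallel>\<close>. By Fatou's lemma the bound passes to the pointwise sum \<open>S c\<close>,
so that the series converges to \<open>S c\<close> in \<open>L\<^sup>2\<close> as well. The lower frame bound makes the frame
algorithm \<open>h \<mapsto> h + (f - S S\<^sup>* h) / B\<close> converge, where \<open>S\<^sup>* h = (\<langle>h, g\<^sub>n\<rangle>)\<^sub>n\<close>. All sequences \<open>S\<^sup>* h\<close>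
are orthogonal to the kernel \<open>N\<close> of \<open>S\<close>, and \<open>\<surd>A \<parallel>S\<^sup>* h\<parallel> \<le> \<parallel>S S\<^sup>* h\<parallel>\<close>, so in the limit each
\<open>f \<in> V\<close> is almost everywhere \<open>S e\<close> for some \<open>e \<in> N\<^sup>\<bottom>\<close> with \<open>\<surd>A \<parallel>e\<parallel> \<le> \<parallel>f\<parallel>\<close>
(\<open>exists_N_perp_coefficients\<close>). As \<open>S\<close> is injective on \<open>N\<^sup>\<bottom>\<close>, even modulo null sets, it follows that \<open>S\<close> is
bounded below there. Consequently \<open>S(N\<^sup>\<bottom>)\<close> contains exactly one representative
of each class in \<open>V\<close>, it is complete because \<open>\<ell>\<^sup>2\<close> is, and its point evaluations satisfy
\<open>|S e(t)| \<le> \<parallel>(g\<^sub>n(t))\<^sub>n\<parallel> \<parallel>S e\<parallel> / \<surd>A\<close>. A space of functions that is complete and has bounded point evaluations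
has a reproducing kernel by the Riesz representation theorem.

This is part (a). The two other parts reduce to it. A Riesz basis is a frame whose synthesis operator
has kernel zero, so \<open>S(\<ell>\<^sup>2) = S(N\<^sup>\<bottom>)\<close>. If the generators are continuous and \<open>C\<close> is bounded,
then the series for \<open>S c\<close> converges uniformly and \<open>S c\<close> is continuous. Two continuous functions that agree almost
everywhere are equal, so for each \<open>c\<close> the sequence \<open>e \<in> N\<^sup>\<bottom>\<close> that represents the class of \<open>S c\<close>
satisfies \<open>S e = S c\<close> everywhere; again \<open>S(\<ell>\<^sup>2) = S(N\<^sup>\<bottom>)\<close>.\<close>

section \<open>Semi-inner products\<close>

text \<open>The algebraic half of a Hilbert space of functions. It is shared by \<open>L\<^sup>2(\<real>)\<close>, whose
inner product is only semidefinite on functions, by \<open>\<ell>\<^sup>2(\<int>)\<close>, and by the reproducing kernel spaces,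
so that Cauchy-Schwarz and the triangle inequality are proved once.\<close>

locale semi_inner_function_space =
  fixes H :: "('e \<Rightarrow> complex) set"
    and ip :: "('e \<Rightarrow> complex) \<Rightarrow> ('e \<Rightarrow> complex) \<Rightarrow> complex"
  assumes zero: "(\<lambda>x. 0) \<in> H"
    and add: "f \<in> H \<Longrightarrow> g \<in> H \<Longrightarrow> (\<lambda>x. f x + g x) \<in> H"
    and scale: "f \<in> H \<Longrightarrow> (\<lambda>x. a * f x) \<in> H"
    and ip_add: "f \<in> H \<Longrightarrow> g \<in> H \<Longrightarrow> h \<in> H \<Longrightarrow> ip (\<lambda>x. f x + g x) h = ip f h + ip g h"
    and ip_scale: "f \<in> H \<Longrightarrow> g \<in> H \<Longrightarrow> ip (\<lambda>x. a * f x) g = a * ip f g"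
    and ip_commute: "f \<in> H \<Longrightarrow> g \<in> H \<Longrightarrow> ip g f = cnj (ip f g)"
    and ip_nonneg: "f \<in> H \<Longrightarrow> 0 \<le> Re (ip f f)"
begin

definition nrm :: "('e \<Rightarrow> complex) \<Rightarrow> real" where
  "nrm f = sqrt (Re (ip f f))"

lemma nrm_nonneg [simp]: "f \<in> H \<Longrightarrow> 0 \<le> nrm f"
  by (simp add: nrm_def ip_nonneg)

lemma diff: "f \<in> H \<Longrightarrow> g \<in> H \<Longrightarrow> (\<lambda>x. f x - g x) \<in> H"
  using add[OF _ scale[of g "-1"], of f] by simp

lemma sum_closed: "(\<And>i. i \<in> I \<Longrightarrow> g i \<in> H) \<Longrightarrow> (\<lambda>x. \<Sum>i\<in>I. a i * g i x) \<in> H"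
  by (induction I rule: infinite_finite_induct) (auto intro!: zero add scale)

lemma ip_zero_left: "f \<in> H \<Longrightarrow> ip (\<lambda>x. 0) f = 0"
  using ip_scale[of f f 0] by simp

lemma ip_add_right:
  assumes "f \<in> H" "g \<in> H" "h \<in> H" shows "ip h (\<lambda>x. f x + g x) = ip h f + ip h g"
  using ip_commute[OF add[OF assms(1,2)] assms(3)] ip_commute[OF assms(1,3)] ip_commute[OF assms(2,3)]
  by (simp add: ip_add assms)

lemma ip_scale_right:
  assumes "f \<in> H" "g \<in> H" shows "ip g (\<lambda>x. a * f x) = cnj a * ip g f"
  using ip_commute[OF scale[OF assms(1)] assms(2), of a] ip_commute[OF assms]
  by (simp add: ip_scale assms)

lemma ip_diff_left:
  assumes "f \<in> H" "g \<in> H" "h \<in> H" shows "ip (\<lambda>x. f x - g x) h = ip f h - ip g h"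
  using ip_add[OF assms(1) scale[OF assms(2), of "-1"] assms(3)] ip_scale[OF assms(2,3), of "-1"] by simp

lemma ip_sum_left:
  assumes "\<And>i. i \<in> I \<Longrightarrow> g i \<in> H" "f \<in> H"
  shows "ip (\<lambda>x. \<Sum>i\<in>I. a i * g i x) f = (\<Sum>i\<in>I. a i * ip (g i) f)"
  using assms
  by (induction I rule: infinite_finite_induct)
     (auto simp: ip_zero_left ip_add ip_scale sum_closed scale)

lemma ip_self:
  assumes "f \<in> H" shows "ip f f = complex_of_real ((nrm f)\<^sup>2)"
proof -
  have "Im (ip f f) = 0" using ip_commute[OF assms assms] by (metis complex_cnj_cancel_iff Reals_cnj_iff complex_is_Real_iff)
  then show ?thesis using ip_nonneg[OF assms] by (simp add: nrm_def complex_eq_iff)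
qed

lemma nrm_scale: "f \<in> H \<Longrightarrow> nrm (\<lambda>x. a * f x) = cmod a * nrm f"
proof -
  assume f: "f \<in> H"
  have "ip (\<lambda>x. a * f x) (\<lambda>x. a * f x) = of_real ((cmod a)\<^sup>2) * ip f f"
    by (simp add: ip_scale ip_scale_right f scale complex_norm_square mult.assoc del: of_real_power)
  then have "Re (ip (\<lambda>x. a * f x) (\<lambda>x. a * f x)) = (cmod a)\<^sup>2 * Re (ip f f)" by simp
  then show ?thesis by (simp add: nrm_def real_sqrt_mult)
qed

lemma nrm_add_square:
  assumes "f \<in> H" "g \<in> H"
  shows "(nrm (\<lambda>x. f x + g x))\<^sup>2 = (nrm f)\<^sup>2 + (nrm g)\<^sup>2 + 2 * Re (ip f g)"
proof -
  have "complex_of_real ((nrm (\<lambda>x. f x + g x))\<^sup>2) = ip f f + ip f g + (cnj (ip f g) + ip g g)"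
    unfolding ip_self[OF add[OF assms], symmetric] using ip_commute[OF assms]
    by (simp add: ip_add ip_add_right assms add)
  also have "\<dots> = complex_of_real ((nrm f)\<^sup>2 + (nrm g)\<^sup>2 + 2 * Re (ip f g))"
    using complex_add_cnj[of "ip f g"] by (simp add: ip_self assms algebra_simps)
  finally show ?thesis using of_real_eq_iff by blast
qed

lemma nrm_diff_square:
  assumes "f \<in> H" "g \<in> H"
  shows "(nrm (\<lambda>x. f x - g x))\<^sup>2 = (nrm f)\<^sup>2 + (nrm g)\<^sup>2 - 2 * Re (ip f g)"
  using nrm_add_square[OF assms(1) scale[OF assms(2), of "-1"]] nrm_scale[OF assms(2), of "-1"]
    ip_scale_right[OF assms(2,1), of "-1"] by simp

end

text \<open>For small \<open>s > 0\<close> the linear term dominates the quadratic one. This is the step from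
minimality to the Euler-Lagrange equation in the Riesz representation theorem.\<close>

lemma nonneg_quadratic_imp_linear_term_nonpos:
  fixes x y :: real
  assumes "\<And>s. 0 < s \<Longrightarrow> 0 \<le> s\<^sup>2 * x - 2 * s * y"
  shows "y \<le> 0"
proof (rule ccontr)
  assume "\<not> y \<le> 0" then have y: "y > 0" by simp
  \<comment> \<open>small enough that \<open>s x \<le> y\<close>, which makes \<open>s (s x - 2 y)\<close> negative\<close>
  define s where "s = y / (\<bar>x\<bar> + 1)"
  have s: "s > 0" using y by (simp add: s_def)
  have "s * x \<le> y" using y by (simp add: s_def divide_simps mult_left_mono)
  moreover have "0 \<le> s * (s * x - 2 * y)" using assms[OF s] by (simp add: power2_eq_square algebra_simps)
  ultimately show False using s y by (simp add: zero_le_mult_iff)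
qed

context semi_inner_function_space
begin

text \<open>The classical discriminant argument, applied to \<open>f - s w g\<close> with \<open>w = \<langle>f, g\<rangle>\<close>. The case
\<open>\<parallel>g\<parallel> = 0\<close> is treated separately, since it does not force \<open>g = 0\<close> here.\<close>

lemma Cauchy_Schwarz:
  assumes "f \<in> H" "g \<in> H" shows "cmod (ip f g) \<le> nrm f * nrm g"
proof -
  define w where "w = ip f g"
  have *: "0 \<le> (nrm f)\<^sup>2 + s\<^sup>2 * (cmod w)\<^sup>2 * (nrm g)\<^sup>2 - 2 * s * (cmod w)\<^sup>2" for s
  proof -
    have "ip f (\<lambda>x. (- complex_of_real s * w) * g x) = - of_real (s * (cmod w)\<^sup>2)"
      unfolding ip_scale_right[OF assms(2,1)] w_def[symmetric] of_real_mult complex_norm_square by simp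
    then show ?thesis
      using zero_le_power2[of "nrm (\<lambda>x. f x + (- complex_of_real s * w) * g x)"]
      unfolding nrm_add_square[OF assms(1) scale[OF assms(2)]] nrm_scale[OF assms(2)]
      by (simp add: norm_mult power_mult_distrib)
  qed
  have "(cmod w)\<^sup>2 \<le> (nrm f)\<^sup>2 * (nrm g)\<^sup>2"
  proof (cases "nrm g = 0")
    case True
    have "2 * s * (cmod w)\<^sup>2 \<le> (nrm f)\<^sup>2" for s using *[of s] True by simp
    \<comment> \<open>if \<open>w \<noteq> 0\<close>, this value of \<open>s\<close> makes the left-hand side \<open>\<parallel>f\<parallel>\<^sup>2 + 1\<close>\<close>
    from this[of "((nrm f)\<^sup>2 + 1) / (2 * (cmod w)\<^sup>2)"] show ?thesis by (simp split: if_splits)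
  next
    case False
    then have g: "(nrm g)\<^sup>2 > 0" by simp
    have "(1/G)\<^sup>2 * W * G - 2 * (1/G) * W = - (W / G)" if "G > 0" for W G :: real
      using that by (simp add: power2_eq_square field_simps)
    from this[OF g, of "(cmod w)\<^sup>2"] have "0 \<le> (nrm f)\<^sup>2 - (cmod w)\<^sup>2 / (nrm g)\<^sup>2"
      using *[of "1 / (nrm g)\<^sup>2"] by linarith
    then show ?thesis using g by (simp add: field_simps)
  qed
  then show ?thesis unfolding w_def power_mult_distrib[symmetric]
    using assms by (intro power2_le_imp_le[OF _ mult_nonneg_nonneg]) auto
qed

lemma nrm_triangle:
  assumes "f \<in> H" "g \<in> H" shows "nrm (\<lambda>x. f x + g x) \<le> nrm f + nrm g"
proof (rule power2_le_imp_le)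
  show "(nrm (\<lambda>x. f x + g x))\<^sup>2 \<le> (nrm f + nrm g)\<^sup>2"
    unfolding nrm_add_square[OF assms] power2_sum
    using Cauchy_Schwarz[OF assms] complex_Re_le_cmod[of "ip f g"] by simp
qed (use assms in simp)

lemma nrm_minus_commute:
  assumes "f \<in> H" "g \<in> H" shows "nrm (\<lambda>x. f x - g x) = nrm (\<lambda>x. g x - f x)"
  using nrm_scale[OF diff[OF assms], of "-1"] by simp

lemma nrm_triangle_sub:
  assumes "f \<in> H" "g \<in> H" shows "nrm f \<le> nrm g + nrm (\<lambda>x. f x - g x)"
  using nrm_triangle[OF assms(2) diff[OF assms]] by simp

lemma nrm_triangle_diff:
  assumes "f \<in> H" "g \<in> H" "h \<in> H"
  shows "nrm (\<lambda>x. f x - h x) \<le> nrm (\<lambda>x. f x - g x) + nrm (\<lambda>x. g x - h x)"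
  using nrm_triangle[OF diff[OF assms(1,2)] diff[OF assms(2,3)]] by simp

lemma abs_nrm_diff_le:
  assumes "f \<in> H" "g \<in> H" shows "\<bar>nrm f - nrm g\<bar> \<le> nrm (\<lambda>x. f x - g x)"
  using nrm_triangle_sub[OF assms] nrm_triangle_sub[OF assms(2,1)] nrm_minus_commute[OF assms] by simp

lemma nrm_tendsto:
  assumes "f \<in> H" "\<And>i. s i \<in> H" "((\<lambda>i. nrm (\<lambda>x. s i x - f x)) \<longlongrightarrow> 0) F"
  shows "((\<lambda>i. nrm (s i)) \<longlongrightarrow> nrm f) F"
proof (rule LIM_zero_cancel, rule Lim_null_comparison[OF _ assms(3)])
  show "\<forall>\<^sub>F i in F. norm (nrm (s i) - nrm f) \<le> nrm (\<lambda>x. s i x - f x)"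
    using abs_nrm_diff_le[OF assms(2,1)] by simp
qed

lemma ip_tendsto:
  assumes "f \<in> H" "\<And>i. s i \<in> H" "h \<in> H" "((\<lambda>i. nrm (\<lambda>x. s i x - f x)) \<longlongrightarrow> 0) F"
  shows "((\<lambda>i. ip (s i) h) \<longlongrightarrow> ip f h) F"
proof (rule LIM_zero_cancel, rule Lim_null_comparison)
  show "\<forall>\<^sub>F i in F. norm (ip (s i) h - ip f h) \<le> nrm (\<lambda>x. s i x - f x) * nrm h"
    using Cauchy_Schwarz[OF diff[OF assms(2,1)] assms(3)] by (simp add: ip_diff_left assms)
  show "((\<lambda>i. nrm (\<lambda>x. s i x - f x) * nrm h) \<longlongrightarrow> 0) F"
    using tendsto_mult_left_zero[OF assms(4)] .
qed

end

sublocale function_Hilbert_space \<subseteq> semi: semi_inner_function_space H ip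
  by unfold_locales (auto intro: zero add scale ip_add ip_scale ip_commute ip_nonneg)

section \<open>Riesz representation and reproducing kernels\<close>

context function_Hilbert_space
begin

text \<open>The representing element minimizes \<open>J f = \<parallel>f\<parallel>\<^sup>2 - 2 Re (l f)\<close>. By the parallelogram
identity a minimizing sequence is Cauchy, and at the minimum the first variation of \<open>J\<close> vanishes in
every direction.\<close>

lemma Riesz_representation:
  assumes add_l: "\<And>f g. f \<in> H \<Longrightarrow> g \<in> H \<Longrightarrow> l (\<lambda>x. f x + g x) = l f + l g"
    and scale_l: "\<And>a f. f \<in> H \<Longrightarrow> l (\<lambda>x. a * f x) = a * l f"
    and bound: "\<And>f. f \<in> H \<Longrightarrow> cmod (l f) \<le> K * semi.nrm f"
  shows "\<exists>q\<in>H. \<forall>f\<in>H. ip f q = l f"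
proof -
  define J where "J f = (semi.nrm f)\<^sup>2 - 2 * Re (l f)" for f
  define m where "m = Inf (J ` H)"
  have diff_l: "l (\<lambda>x. f x - g x) = l f - l g" if "f \<in> H" "g \<in> H" for f g
    using add_l[OF that(1) scale[OF that(2), of "-1"]] scale_l[OF that(2), of "-1"] by simp
  have J_below: "- K\<^sup>2 \<le> J f" if "f \<in> H" for f
  proof -
    have "Re (l f) \<le> K * semi.nrm f"
      using bound[OF that] complex_Re_le_cmod[of "l f"] by linarith
    moreover have "0 \<le> (semi.nrm f - K)\<^sup>2" by simp
    ultimately show ?thesis by (simp add: J_def power2_diff algebra_simps)
  qed
  then have bdd: "bdd_below (J ` H)" by (auto intro!: bdd_belowI2)
  have m_le: "m \<le> J f" if "f \<in> H" for f
    unfolding m_def using that bdd by (auto intro: cInf_lower)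
  have "\<exists>f\<in>H. J f < m + 1 / Suc k" for k
    using cInf_lessD[of "J ` H" "m + 1 / Suc k"] zero unfolding m_def by fastforce
  then obtain s where sH: "\<And>k. s k \<in> H" and sJ: "\<And>k. J (s k) < m + 1 / Suc k" by metis
  \<comment> \<open>the parallelogram identity at the midpoint of \<open>f\<close> and \<open>g\<close>, where \<open>J\<close> is at least \<open>m\<close>\<close>
  have mid: "(semi.nrm (\<lambda>x. f x - g x))\<^sup>2 \<le> 2 * (J f - m) + 2 * (J g - m)"
    if fg: "f \<in> H" "g \<in> H" for f g
  proof -
    define h where "h = (\<lambda>x. (1/2) * (f x + g x))"
    have h: "h \<in> H" unfolding h_def by (intro scale add fg)
    have "4 * (semi.nrm h)\<^sup>2 = (semi.nrm f)\<^sup>2 + (semi.nrm g)\<^sup>2 + 2 * Re (ip f g)"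
      unfolding h_def semi.nrm_scale[OF add[OF fg]] power_mult_distrib semi.nrm_add_square[OF fg]
      by (simp add: power2_eq_square)
    moreover have "2 * Re (l h) = Re (l f) + Re (l g)"
      by (simp only: h_def scale_l[OF add[OF fg]] add_l[OF fg]) simp
    ultimately have "(semi.nrm (\<lambda>x. f x - g x))\<^sup>2 = 2 * J f + 2 * J g - 4 * J h"
      unfolding semi.nrm_diff_square[OF fg] J_def by (simp add: algebra_simps)
    then show ?thesis using m_le[OF h] by simp
  qed
  have "\<exists>q\<in>H. (\<lambda>n. semi.nrm (\<lambda>x. s n x - q x)) \<longlonglongrightarrow> 0"
    unfolding semi.nrm_def
  proof (intro complete sH allI impI)
    fix e :: real assume e: "e > 0"
    then obtain N where N: "4 / Suc N < e\<^sup>2"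
      using reals_Archimedean[of "e\<^sup>2/4"] by (auto simp: field_simps)
    show "\<exists>N. \<forall>m\<ge>N. \<forall>n\<ge>N.
      sqrt (Re (ip (\<lambda>x. s m x - s n x) (\<lambda>x. s m x - s n x))) < e"
    proof (intro exI allI impI)
      fix j k assume jk: "N \<le> j" "N \<le> k"
      have "1 / real (Suc j) \<le> 1 / Suc N" "1 / real (Suc k) \<le> 1 / Suc N"
        using jk by (auto intro!: divide_left_mono)
      then have "2 * (J (s j) - m) + 2 * (J (s k) - m) < 4 * (1 / Suc N)"
        using sJ[of j] sJ[of k] by argo
      then have "(semi.nrm (\<lambda>x. s j x - s k x))\<^sup>2 < e\<^sup>2"
        using mid[OF sH sH, of j k] N by simp
      then show "sqrt (Re (ip (\<lambda>x. s j x - s k x) (\<lambda>x. s j x - s k x))) < e"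
        using e power_less_imp_less_base[of _ 2 e] by (simp add: semi.nrm_def)
    qed
  qed
  then obtain q where q: "q \<in> H" and lim: "(\<lambda>n. semi.nrm (\<lambda>x. s n x - q x)) \<longlonglongrightarrow> 0" by blast
  have "(\<lambda>n. l (s n)) \<longlonglongrightarrow> l q"
  proof (rule LIM_zero_cancel, rule Lim_null_comparison)
    show "\<forall>\<^sub>F n in sequentially. norm (l (s n) - l q) \<le> K * semi.nrm (\<lambda>x. s n x - q x)"
      using bound[OF semi.diff[OF sH q]] by (simp add: diff_l sH q)
    show "(\<lambda>n. K * semi.nrm (\<lambda>x. s n x - q x)) \<longlonglongrightarrow> 0"
      using tendsto_mult_right_zero[OF lim] .
  qed
  then have "(\<lambda>n. J (s n)) \<longlonglongrightarrow> J q"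
    unfolding J_def using semi.nrm_tendsto[OF q sH lim] by (intro tendsto_intros)
  moreover have "(\<lambda>n. m + 1 / Suc n) \<longlonglongrightarrow> m + 0"
    by (intro tendsto_intros LIMSEQ_Suc[OF lim_1_over_n])
  ultimately have "J q \<le> m + 0"
    by (rule LIMSEQ_le) (use sJ less_imp_le in blast)
  then have J_q: "J q \<le> m" by simp
  have "ip f q = l f" if f: "f \<in> H" for f
  proof -
    define w where "w = ip f q - l f"
    have "0 \<le> t\<^sup>2 * ((cmod w)\<^sup>2 * (semi.nrm f)\<^sup>2) - 2 * t * (cmod w)\<^sup>2" for t
    proof -
      \<comment> \<open>the direction in which the first variation is \<open>-2 t |w|\<^sup>2\<close>\<close>
      define a where "a = - (complex_of_real t * cnj w)"
      have aw: "a * ip f q - a * l f = - of_real (t * (cmod w)\<^sup>2)"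
        unfolding right_diff_distrib[symmetric] w_def[symmetric] a_def of_real_mult complex_norm_square
        by simp
      have "Re (ip q (\<lambda>x. a * f x)) = Re (a * ip f q)"
        unfolding semi.ip_scale_right[OF f q] ip_commute[OF f q]
        by (simp flip: complex_cnj_mult)
      then have "J (\<lambda>x. q x + a * f x) = J q + (cmod a)\<^sup>2 * (semi.nrm f)\<^sup>2 + 2 * Re (a * ip f q - a * l f)"
        unfolding J_def semi.nrm_add_square[OF q scale[OF f]] semi.nrm_scale[OF f]
          add_l[OF q scale[OF f]] scale_l[OF f] by (simp add: power_mult_distrib)
      moreover have "J q \<le> J (\<lambda>x. q x + a * f x)" using J_q m_le[OF add[OF q scale[OF f, of a]]] by simp

      ultimately show ?thesis unfolding aw by (simp add: a_def norm_mult power_mult_distrib algebra_simps)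
    qed
    then have "(cmod w)\<^sup>2 \<le> 0" by (rule nonneg_quadratic_imp_linear_term_nonpos)
    then show ?thesis by (simp add: w_def)
  qed
  with q show ?thesis by blast
qed

lemma bounded_evaluations_imp_reproducing_kernel:
  assumes "\<And>t. \<exists>K. \<forall>f\<in>H. cmod (f t) \<le> K * semi.nrm f"
  shows "reproducing_kernel_Hilbert_space H ip"
proof (unfold_locales)
  have "\<exists>q\<in>H. \<forall>f\<in>H. ip f q = f t" for t
  proof -
    obtain K where "\<forall>f\<in>H. cmod (f t) \<le> K * semi.nrm f" using assms by blast
    then show ?thesis by (intro Riesz_representation[where l = "\<lambda>f. f t" and K = K]) auto
  qed
  then obtain q where "\<And>t. q t \<in> H" "\<And>t f. f \<in> H \<Longrightarrow> ip f (q t) = f t" by metis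
  then show "\<exists>q. (\<forall>t. (\<lambda>s. q s t) \<in> H) \<and> (\<forall>f\<in>H. \<forall>t. ip f (\<lambda>s. q s t) = f t)"
    by (intro exI[of _ "\<lambda>s t. q t s"]) auto
qed

end

section \<open>Square-integrable functions\<close>

text \<open>This makes square-integrability and square-summability stable under addition.\<close>

lemma cmod_add_square_le: "(cmod (a + b))\<^sup>2 \<le> 2 * (cmod a)\<^sup>2 + 2 * (cmod b)\<^sup>2"
proof -
  have "(cmod (a + b))\<^sup>2 \<le> (cmod a + cmod b)\<^sup>2" by (intro power_mono norm_triangle_ineq) simp
  moreover have "0 \<le> (cmod a - cmod b)\<^sup>2" by simp
  ultimately show ?thesis by (simp add: power2_sum power2_diff)
qed

lemma borel_measurable_L2 [measurable_dest]: "f \<in> L2 \<Longrightarrow> f \<in> borel_measurable lebesgue"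
  by (simp add: L2_def)

lemma borel_measurable_cnj [measurable]:
  "f \<in> borel_measurable M \<Longrightarrow> (\<lambda>t. cnj (f t)) \<in> borel_measurable M"
  by (rule measurable_compose[of f M borel cnj]) (auto intro!: borel_measurable_continuous_onI continuous_intros)

lemma integrable_L2_square: "f \<in> L2 \<Longrightarrow> integrable lebesgue (\<lambda>t. (cmod (f t))\<^sup>2)"
  by (simp add: L2_def)

lemma L2_zero: "(\<lambda>t. 0) \<in> L2" by (simp add: L2_def)

lemma L2_add:
  assumes [measurable]: "f \<in> L2" "g \<in> L2" shows "(\<lambda>t. f t + g t) \<in> L2"
proof -
  have "integrable lebesgue (\<lambda>t. 2 * (cmod (f t))\<^sup>2 + 2 * (cmod (g t))\<^sup>2)"
    by (intro Bochner_Integration.integrable_add integrable_mult_right integrable_L2_square assms)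
  then have "integrable lebesgue (\<lambda>t. (cmod (f t + g t))\<^sup>2)"
    by (rule Bochner_Integration.integrable_bound) (auto simp: cmod_add_square_le)
  then show ?thesis by (simp add: L2_def)
qed

lemma L2_scale:
  assumes [measurable]: "f \<in> L2" shows "(\<lambda>t. a * f t) \<in> L2"
  using integrable_L2_square[OF assms] by (simp add: L2_def norm_mult power_mult_distrib)

lemma integrable_L2_mult:
  assumes [measurable]: "f \<in> L2" "g \<in> L2" shows "integrable lebesgue (\<lambda>t. f t * cnj (g t))"
proof (rule Bochner_Integration.integrable_bound)
  show "integrable lebesgue (\<lambda>t. (cmod (f t))\<^sup>2 + (cmod (g t))\<^sup>2)"
    by (intro Bochner_Integration.integrable_add integrable_L2_square assms)
  have "a * b \<le> a\<^sup>2 + b\<^sup>2" if "0 \<le> a" "0 \<le> b" for a b :: real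
    using sum_squares_bound[of a b] mult_nonneg_nonneg[OF that] by linarith
  then show "AE t in lebesgue. norm (f t * cnj (g t)) \<le> norm ((cmod (f t))\<^sup>2 + (cmod (g t))\<^sup>2)"
    by (simp add: norm_mult)
qed measurable

lemma L2_inner_self: "L2_inner f f = complex_of_real (LINT t|lebesgue. (cmod (f t))\<^sup>2)"
  unfolding L2_inner_def complex_norm_square[symmetric] by (rule integral_complex_of_real)

interpretation L2: semi_inner_function_space L2 L2_inner
  rewrites nrm_L2: "semi_inner_function_space.nrm L2_inner = L2_norm"
proof -
  show S: "semi_inner_function_space L2 L2_inner"
  proof
    show "L2_inner g f = cnj (L2_inner f g)" for f g
      unfolding L2_inner_def by (subst Bochner_Integration.integral_cnj[symmetric]) (simp add: mult.commute)
    show "0 \<le> Re (L2_inner f f)" for f by (simp add: L2_inner_self)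
    show "L2_inner (\<lambda>x. a * f x) g = a * L2_inner f g" for f g a
      by (simp add: L2_inner_def mult.assoc)
    show "L2_inner (\<lambda>x. f x + g x) h = L2_inner f h + L2_inner g h"
      if "f \<in> L2" "g \<in> L2" "h \<in> L2" for f g h
      using that by (simp add: L2_inner_def distrib_right integrable_L2_mult)
  qed (auto intro: L2_zero L2_add L2_scale)
  show "semi_inner_function_space.nrm L2_inner = L2_norm"
    unfolding semi_inner_function_space.nrm_def[OF S] L2_norm_def by (simp add: L2_inner_self fun_eq_iff)
qed

lemma L2_norm_eq_0_iff_AE:
  assumes "f \<in> L2" shows "L2_norm f = 0 \<longleftrightarrow> (AE t in lebesgue. f t = 0)"
  unfolding L2_norm_def real_sqrt_eq_0_iff
  using integral_nonneg_eq_0_iff_AE[OF integrable_L2_square[OF assms]] by simp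

lemma L2_norm_diff_eq_0_iff_AE:
  assumes "f \<in> L2" "g \<in> L2"
  shows "L2_norm (\<lambda>t. f t - g t) = 0 \<longleftrightarrow> (AE t in lebesgue. f t = g t)"
  using L2_norm_eq_0_iff_AE[OF L2.diff[OF assms]] by simp

lemma L2_norm_cong_AE:
  assumes [measurable]: "f \<in> L2" "g \<in> L2" and "AE t in lebesgue. f t = g t"
  shows "L2_norm f = L2_norm g"
  unfolding L2_norm_def using assms(3) by (intro arg_cong[of _ _ sqrt] integral_cong_AE) auto

text \<open>Fatou's lemma for \<open>|s k|\<^sup>2\<close>. Applied to partial sums, it bounds the pointwise sum of a series
in \<open>L\<^sup>2\<close>.\<close>

lemma L2_Fatou:
  assumes s [measurable]: "\<And>k. s k \<in> L2" and lim: "\<And>t. (\<lambda>k. s k t) \<longlonglongrightarrow> f t"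
    and bound: "\<And>k. L2_norm (s k) \<le> M"
  shows "f \<in> L2" and "L2_norm f \<le> M"
proof -
  have f [measurable]: "f \<in> borel_measurable lebesgue"
    by (rule borel_measurable_LIMSEQ_metric[OF borel_measurable_L2[OF s] lim])
  have M: "0 \<le> M" using L2.nrm_nonneg[OF s] bound by (meson order_trans)
  have sq: "(LINT t|lebesgue. (cmod (s k t))\<^sup>2) \<le> M\<^sup>2" for k
    using bound[of k] unfolding L2_norm_def by (simp add: real_le_rsqrt sqrt_le_D)
  have "(\<integral>\<^sup>+t. ennreal ((cmod (f t))\<^sup>2) \<partial>lebesgue) =
      (\<integral>\<^sup>+t. liminf (\<lambda>k. ennreal ((cmod (s k t))\<^sup>2)) \<partial>lebesgue)"
    by (intro nn_integral_cong lim_imp_Liminf[symmetric] tendsto_ennrealI tendsto_intros lim)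
       simp_all
  also have "\<dots> \<le> liminf (\<lambda>k. \<integral>\<^sup>+t. ennreal ((cmod (s k t))\<^sup>2) \<partial>lebesgue)"
    by (rule nn_integral_liminf) measurable
  also have "\<dots> \<le> ennreal (M\<^sup>2)"
  proof (rule Liminf_le)
    show "\<forall>\<^sub>F k in sequentially. (\<integral>\<^sup>+t. ennreal ((cmod (s k t))\<^sup>2) \<partial>lebesgue) \<le> ennreal (M\<^sup>2)"
      using nn_integral_eq_integral[OF integrable_L2_square[OF s]] sq
      by (simp add: ennreal_leI)
  qed simp
  finally have le: "(\<integral>\<^sup>+t. ennreal ((cmod (f t))\<^sup>2) \<partial>lebesgue) \<le> ennreal (M\<^sup>2)" .
  have int: "integrable lebesgue (\<lambda>t. (cmod (f t))\<^sup>2)"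
    using le by (intro integrableI_nonneg) (auto intro: le_less_trans ennreal_less_top)
  then show "f \<in> L2" by (simp add: L2_def)
  have "(LINT t|lebesgue. (cmod (f t))\<^sup>2) \<le> M\<^sup>2"
    using le nn_integral_eq_integral[OF int] by simp
  then show "L2_norm f \<le> M" unfolding L2_norm_def using M real_le_lsqrt by auto
qed

section \<open>Square-summable sequences\<close>

lemma ell2_D: "c \<in> ell2 \<Longrightarrow> (\<lambda>n. (cmod (c n))\<^sup>2) summable_on UNIV"
  by (simp add: ell2_def)

lemma ell2_finite_support:
  assumes "finite F" "\<And>n. n \<notin> F \<Longrightarrow> c n = 0"
  shows "c \<in> ell2"
proof -
  have "{n. (cmod (c n))\<^sup>2 \<noteq> 0} \<subseteq> F" using assms(2) by auto
  then have "finite {n \<in> UNIV. (cmod (c n))\<^sup>2 \<noteq> 0}" using assms(1) by (simp add: finite_subset)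
  then show "c \<in> ell2" unfolding ell2_def by (simp add: finite_nonzero_values_imp_summable_on)
qed

lemma ell2_zero: "(\<lambda>n. 0) \<in> ell2" by (simp add: ell2_def)

lemma ell2_add: assumes "c \<in> ell2" "d \<in> ell2" shows "(\<lambda>n. c n + d n) \<in> ell2"
proof -
  have "(\<lambda>n. 2 * (cmod (c n))\<^sup>2 + 2 * (cmod (d n))\<^sup>2) summable_on UNIV"
    using assms by (intro summable_on_add summable_on_cmult_right) (auto dest: ell2_D)
  then have "(\<lambda>n. (cmod (c n + d n))\<^sup>2) summable_on UNIV"
    by (rule summable_on_comparison_test) (auto simp: cmod_add_square_le)
  then show ?thesis by (simp add: ell2_def)
qed

lemma ell2_scale: "c \<in> ell2 \<Longrightarrow> (\<lambda>n. a * c n) \<in> ell2"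
  by (simp add: ell2_def norm_mult power_mult_distrib summable_on_cmult_right)

lemma ell2_cnj_iff: "(\<lambda>n. cnj (c n)) \<in> ell2 \<longleftrightarrow> c \<in> ell2" by (simp add: ell2_def)

lemma ell2_mult_abs_summable:
  assumes "c \<in> ell2" "d \<in> ell2" shows "(\<lambda>n. cmod (c n * d n)) summable_on UNIV"
  by (rule abs_summable_product)
     (use assms[THEN ell2_D] in \<open>simp_all add: norm_mult power2_eq_square\<close>)

lemma ell2_mult_summable:
  assumes "c \<in> ell2" "d \<in> ell2" shows "(\<lambda>n. c n * cnj (d n)) summable_on UNIV"
  by (rule abs_summable_summable, rule ell2_mult_abs_summable) (use assms in \<open>simp_all add: ell2_cnj_iff\<close>)

lemma ell2_inner_self: "ell2_inner c c = complex_of_real (\<Sum>\<^sub>\<infinity>n. (cmod (c n))\<^sup>2)"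
  unfolding ell2_inner_def complex_norm_square[symmetric]
proof (rule infsum_bounded_linear_strong[OF _ bounded_linear_of_real])
  show "(\<lambda>n. complex_of_real ((cmod (c n))\<^sup>2)) summable_on UNIV \<longleftrightarrow> (\<lambda>n. (cmod (c n))\<^sup>2) summable_on UNIV"
    using summable_on_Re[of "\<lambda>n. complex_of_real ((cmod (c n))\<^sup>2)"] summable_on_of_real by fastforce
qed

interpretation ell2: semi_inner_function_space ell2 ell2_inner
  rewrites nrm_ell2: "semi_inner_function_space.nrm ell2_inner = ell2_norm"
proof -
  show S: "semi_inner_function_space ell2 ell2_inner"
  proof
    show "ell2_inner d c = cnj (ell2_inner c d)" for c d
      unfolding ell2_inner_def infsum_cnj[symmetric] by (simp add: mult.commute)
    show "0 \<le> Re (ell2_inner c c)" for c by (simp add: ell2_inner_self infsum_nonneg)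
    show "ell2_inner (\<lambda>n. a * c n) d = a * ell2_inner c d" for c d a
      by (simp add: ell2_inner_def mult.assoc infsum_cmult_right')
    show "ell2_inner (\<lambda>n. b n + c n) d = ell2_inner b d + ell2_inner c d"
      if "b \<in> ell2" "c \<in> ell2" "d \<in> ell2" for b c d
      using that by (simp add: ell2_inner_def distrib_right infsum_add ell2_mult_summable)
  qed (auto intro: ell2_zero ell2_add ell2_scale)
  show "semi_inner_function_space.nrm ell2_inner = ell2_norm"
    unfolding semi_inner_function_space.nrm_def[OF S] ell2_norm_def by (simp add: ell2_inner_self fun_eq_iff)
qed

lemma ell2_norm_square: "(ell2_norm c)\<^sup>2 = (\<Sum>\<^sub>\<infinity>n. (cmod (c n))\<^sup>2)"
  by (simp add: ell2_norm_def infsum_nonneg)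

lemma sum_le_ell2_norm_square:
  assumes "c \<in> ell2" "finite F"
  shows "(\<Sum>n\<in>F. (cmod (c n))\<^sup>2) \<le> (ell2_norm c)\<^sup>2"
  unfolding ell2_norm_square by (rule finite_sum_le_infsum[OF ell2_D]) (use assms in simp_all)

lemma cmod_le_ell2_norm:
  assumes "c \<in> ell2" shows "cmod (c n) \<le> ell2_norm c"
proof (rule power2_le_imp_le)
  show "(cmod (c n))\<^sup>2 \<le> (ell2_norm c)\<^sup>2" using sum_le_ell2_norm_square[OF assms, of "{n}"] by simp
qed (rule ell2.nrm_nonneg[OF assms])

lemma ell2_I_bounded:
  assumes "\<And>F. finite F \<Longrightarrow> (\<Sum>n\<in>F. (cmod (c n))\<^sup>2) \<le> M\<^sup>2" "0 \<le> M"
  shows "c \<in> ell2" and "ell2_norm c \<le> M"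
proof -
  have s: "(\<lambda>n. (cmod (c n))\<^sup>2) summable_on UNIV"
    by (rule nonneg_bdd_above_summable_on) (use assms in \<open>auto intro!: bdd_aboveI2\<close>)
  then show "c \<in> ell2" by (simp add: ell2_def)
  have "(\<Sum>\<^sub>\<infinity>n. (cmod (c n))\<^sup>2) \<le> M\<^sup>2" using s assms by (intro infsum_le_finite_sums) auto
  then show "ell2_norm c \<le> M" unfolding ell2_norm_def using assms(2) by (rule real_le_lsqrt[rotated])
qed

lemma ell2_norm_finite_support:
  assumes "finite F" "\<And>n. n \<notin> F \<Longrightarrow> c n = 0"
  shows "(ell2_norm c)\<^sup>2 = (\<Sum>n\<in>F. (cmod (c n))\<^sup>2)"
proof -
  have "(\<Sum>\<^sub>\<infinity>n. (cmod (c n))\<^sup>2) = (\<Sum>\<^sub>\<infinity>n\<in>F. (cmod (c n))\<^sup>2)"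
    by (rule infsum_cong_neutral) (use assms(2) in auto)
  then show ?thesis using assms(1) by (simp add: ell2_norm_square)
qed

lemma ell2_norm_eq_0: "c \<in> ell2 \<Longrightarrow> ell2_norm c = 0 \<Longrightarrow> c = (\<lambda>n. 0)"
  using cmod_le_ell2_norm[of c] by (auto simp: fun_eq_iff)

text \<open>The coordinatewise limit is the limit in norm, because bounds on finite partial sums
survive the passage to the limit.\<close>

lemma ell2_complete:
  assumes s: "\<And>k. s k \<in> ell2"
    and cauchy: "\<And>e. e > 0 \<Longrightarrow> \<exists>N::nat. \<forall>j\<ge>N. \<forall>k\<ge>N. ell2_norm (\<lambda>n. s j n - s k n) < e"
  shows "\<exists>d\<in>ell2. (\<lambda>k. ell2_norm (\<lambda>n. s k n - d n)) \<longlonglongrightarrow> 0"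
proof -
  have "Cauchy (\<lambda>k. s k n)" for n
  proof (rule metric_CauchyI)
    fix e :: real assume "e > 0"
    then obtain N where "\<forall>j\<ge>N. \<forall>k\<ge>N. ell2_norm (\<lambda>n. s j n - s k n) < e" using cauchy by blast
    then show "\<exists>N. \<forall>j\<ge>N. \<forall>k\<ge>N. dist (s j n) (s k n) < e"
      using cmod_le_ell2_norm[OF ell2.diff[OF s s], of _ n] unfolding dist_norm by (meson le_less_trans)
  qed
  then have "\<exists>l. (\<lambda>k. s k n) \<longlonglongrightarrow> l" for n using Cauchy_convergent convergent_def by blast
  then obtain d where d: "\<And>n. (\<lambda>k. s k n) \<longlonglongrightarrow> d n" by metis
  have tail: "\<exists>N. \<forall>j\<ge>N. (\<lambda>n. s j n - d n) \<in> ell2 \<and> ell2_norm (\<lambda>n. s j n - d n) \<le> e" if "e > 0" for e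
  proof -
    obtain N where N: "\<And>j k. j \<ge> N \<Longrightarrow> k \<ge> N \<Longrightarrow> ell2_norm (\<lambda>n. s j n - s k n) < e"
      using cauchy \<open>e > 0\<close> by blast
    have "(\<Sum>n\<in>F. (cmod (s j n - d n))\<^sup>2) \<le> e\<^sup>2" if "j \<ge> N" "finite F" for j F
    proof (rule tendsto_upperbound)
      show "((\<lambda>k. \<Sum>n\<in>F. (cmod (s j n - s k n))\<^sup>2) \<longlongrightarrow> (\<Sum>n\<in>F. (cmod (s j n - d n))\<^sup>2)) sequentially"
        by (intro tendsto_intros d)
      have "(\<Sum>n\<in>F. (cmod (s j n - s k n))\<^sup>2) \<le> e\<^sup>2" if "k \<ge> N" for k
        using sum_le_ell2_norm_square[OF ell2.diff[OF s[of j] s[of k]] \<open>finite F\<close>]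
          power_mono[OF less_imp_le[OF N[OF \<open>j \<ge> N\<close> that]], of 2] ell2.nrm_nonneg[OF ell2.diff[OF s[of j] s[of k]]]
        by linarith
      then show "\<forall>\<^sub>F k in sequentially. (\<Sum>n\<in>F. (cmod (s j n - s k n))\<^sup>2) \<le> e\<^sup>2"
        using eventually_sequentially by blast
    qed simp
    with \<open>e > 0\<close> show ?thesis using ell2_I_bounded[where M = e] by (meson less_imp_le)
  qed
  obtain N where "(\<lambda>n. s N n - d n) \<in> ell2" using tail[of 1] by auto
  then have "d \<in> ell2" using ell2.diff[OF s[of N]] by fastforce
  moreover have "(\<lambda>k. ell2_norm (\<lambda>n. s k n - d n)) \<longlonglongrightarrow> 0"
  proof (rule LIMSEQ_I)
    fix r :: real assume "r > 0"
    then obtain N where "\<forall>j\<ge>N. ell2_norm (\<lambda>n. s j n - d n) \<le> r/2" using tail[of "r/2"] by auto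
    with \<open>r > 0\<close> show "\<exists>N. \<forall>k\<ge>N. norm (ell2_norm (\<lambda>n. s k n - d n) - 0) < r"
      using ell2.nrm_nonneg[OF ell2.diff[OF s \<open>d \<in> ell2\<close>]] by (intro exI[of _ N]) fastforce
  qed
  ultimately show ?thesis by blast
qed

section \<open>Closed spans, frames and Riesz bases\<close>

lemma L2_closed_span_L2: "f \<in> L2_closed_span g \<Longrightarrow> f \<in> L2"
  by (simp add: L2_closed_span_def)

lemma finite_combination_in_closed_span:
  assumes "\<And>n. g n \<in> L2" "finite F"
  shows "(\<lambda>t. \<Sum>n\<in>F. a n * g n t) \<in> L2_closed_span g"
  unfolding L2_closed_span_def
proof (intro CollectI conjI allI impI exI)
  fix e :: real assume "e > 0"
  then show "L2_norm (\<lambda>t. (\<Sum>n\<in>F. a n * g n t) - (\<Sum>n\<in>F. a n * g n t)) < e"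
    by (simp add: L2_norm_def)
qed (use assms in \<open>auto intro: L2.sum_closed\<close>)

lemma closed_span_scale:
  assumes g: "\<And>n. g n \<in> L2" and f: "f \<in> L2_closed_span g"
  shows "(\<lambda>t. b * f t) \<in> L2_closed_span g"
proof -
  have fL: "f \<in> L2" using f by (rule L2_closed_span_L2)
  have "\<exists>F a. finite F \<and> L2_norm (\<lambda>t. b * f t - (\<Sum>n\<in>F. a n * g n t)) < e" if "e > 0" for e
  proof -
    have "e / (cmod b + 1) > 0" using that by (simp add: add_nonneg_pos)
    then obtain F a where F: "finite F" and le: "L2_norm (\<lambda>t. f t - (\<Sum>n\<in>F. a n * g n t)) < e / (cmod b + 1)"
      using f unfolding L2_closed_span_def by blast
    have p: "(\<lambda>t. \<Sum>n\<in>F. a n * g n t) \<in> L2" using g by (auto intro: L2.sum_closed)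
    have "L2_norm (\<lambda>t. b * f t - (\<Sum>n\<in>F. (b * a n) * g n t)) = cmod b * L2_norm (\<lambda>t. f t - (\<Sum>n\<in>F. a n * g n t))"
      unfolding L2.nrm_scale[OF L2.diff[OF fL p], symmetric]
      by (simp add: right_diff_distrib sum_distrib_left mult.assoc)
    also have "\<dots> \<le> (cmod b + 1) * L2_norm (\<lambda>t. f t - (\<Sum>n\<in>F. a n * g n t))"
      by (intro mult_right_mono L2.nrm_nonneg L2.diff fL p) simp
    also have "\<dots> < e" using le by (simp add: less_divide_eq add_nonneg_pos mult.commute)
    finally show ?thesis using F by (intro exI[of _ F] exI[of _ "\<lambda>n. b * a n"] conjI)
  qed
  then show ?thesis using L2.scale[OF fL] by (simp add: L2_closed_span_def)
qed

text \<open>Two finite combinations over different index sets are added by extending the coefficients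
by zero to the union.\<close>

lemma closed_span_add:
  assumes g: "\<And>n. g n \<in> L2" and f: "f \<in> L2_closed_span g" and h: "h \<in> L2_closed_span g"
  shows "(\<lambda>t. f t + h t) \<in> L2_closed_span g"
proof -
  have fL: "f \<in> L2" "h \<in> L2" using f h by (auto intro: L2_closed_span_L2)
  have "\<exists>F a. finite F \<and> L2_norm (\<lambda>t. f t + h t - (\<Sum>n\<in>F. a n * g n t)) < e" if e: "e > 0" for e
  proof -
    obtain F a where F: "finite F" and lf: "L2_norm (\<lambda>t. f t - (\<Sum>n\<in>F. a n * g n t)) < e / 2"
      using f half_gt_zero[OF e] unfolding L2_closed_span_def by blast
    obtain G b where G: "finite G" and lh: "L2_norm (\<lambda>t. h t - (\<Sum>n\<in>G. b n * g n t)) < e / 2"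
      using h half_gt_zero[OF e] unfolding L2_closed_span_def by blast
    define c where "c n = (if n \<in> F then a n else 0) + (if n \<in> G then b n else 0)" for n
    have "(\<Sum>n\<in>F \<union> G. (if n \<in> F then a n else 0) * g n t) = (\<Sum>n\<in>F. a n * g n t)"
      "(\<Sum>n\<in>F \<union> G. (if n \<in> G then b n else 0) * g n t) = (\<Sum>n\<in>G. b n * g n t)" for t
      using F G by (auto intro: sum.mono_neutral_cong_right)
    then have c: "(\<Sum>n\<in>F \<union> G. c n * g n t) = (\<Sum>n\<in>F. a n * g n t) + (\<Sum>n\<in>G. b n * g n t)" for t
      by (simp only: c_def distrib_right sum.distrib)
    have "L2_norm (\<lambda>t. f t + h t - (\<Sum>n\<in>F \<union> G. c n * g n t)) =
        L2_norm (\<lambda>t. (f t - (\<Sum>n\<in>F. a n * g n t)) + (h t - (\<Sum>n\<in>G. b n * g n t)))"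
      unfolding c by (simp add: algebra_simps)
    also have "\<dots> \<le> L2_norm (\<lambda>t. f t - (\<Sum>n\<in>F. a n * g n t)) + L2_norm (\<lambda>t. h t - (\<Sum>n\<in>G. b n * g n t))"
      by (intro L2.nrm_triangle L2.diff fL L2.sum_closed g)
    also have "\<dots> < e" using lf lh by simp
    finally show ?thesis using F G by (intro exI[of _ "F \<union> G"] exI[of _ c] conjI finite_UnI)
  qed
  then show ?thesis using L2.add[OF fL] by (simp add: L2_closed_span_def)
qed

lemma closed_span_approximating_sequence:
  assumes "f \<in> L2_closed_span g"
  obtains F a where "\<And>k::nat. finite (F k)"
    and "(\<lambda>k. L2_norm (\<lambda>t. f t - (\<Sum>n\<in>F k. a k n * g n t))) \<longlonglongrightarrow> 0"
proof -
  have f: "f \<in> L2" and "\<exists>F a. finite F \<and> L2_norm (\<lambda>t. f t - (\<Sum>n\<in>F. a n * g n t)) < 1 / Suc k" for k :: nat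
    using assms unfolding L2_closed_span_def by auto
  then obtain F a where F: "\<And>k. finite (F k)"
    and le: "\<And>k. L2_norm (\<lambda>t. f t - (\<Sum>n\<in>F k. a k n * g n t)) < 1 / Suc k" by metis
  have "(\<lambda>k. L2_norm (\<lambda>t. f t - (\<Sum>n\<in>F k. a k n * g n t))) \<longlonglongrightarrow> 0"
  proof (rule Lim_null_comparison)
    show "\<forall>\<^sub>F k in sequentially. norm (L2_norm (\<lambda>t. f t - (\<Sum>n\<in>F k. a k n * g n t))) \<le> 1 / Suc k"
      using le by (intro always_eventually allI) (simp add: L2_norm_def less_imp_le)
    show "(\<lambda>k. 1 / Suc k) \<longlonglongrightarrow> 0" by (rule LIMSEQ_Suc[OF lim_1_over_n])
  qed
  with F show ?thesis by (rule that)
qed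

text \<open>The analysis operator \<open>h \<mapsto> (\<langle>h, g\<^sub>n\<rangle>)\<^sub>n\<close>, adjoint to the synthesis operator below.\<close>

definition analysis :: "(int \<Rightarrow> real \<Rightarrow> complex) \<Rightarrow> (real \<Rightarrow> complex) \<Rightarrow> int \<Rightarrow> complex" where
  "analysis g h n = L2_inner h (g n)"

text \<open>Expand \<open>\<parallel>p\<parallel>\<^sup>2 = \<Sum> a(n) \<langle>g\<^sub>n, p\<rangle>\<close> and apply Cauchy-Schwarz to the sum. An upper bound on
the analysis side gives an upper bound for \<open>\<parallel>p\<parallel>\<close>; a lower bound of \<open>\<parallel>p\<parallel>\<close> in terms of \<open>a\<close> gives a lower
frame bound at \<open>p\<close>.\<close>

lemma square_norm_finite_combination_le:
  assumes g: "\<And>n. g n \<in> L2" and p_def: "p = (\<lambda>t. \<Sum>n\<in>F. a n * g n t)"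
  shows "((L2_norm p)\<^sup>2)\<^sup>2 \<le> (\<Sum>n\<in>F. (cmod (a n))\<^sup>2) * (\<Sum>n\<in>F. (cmod (analysis g p n))\<^sup>2)"
proof -
  have p: "p \<in> L2" unfolding p_def using g by (rule L2.sum_closed)
  have "complex_of_real ((L2_norm p)\<^sup>2) = (\<Sum>n\<in>F. a n * L2_inner (g n) p)"
    unfolding L2.ip_self[OF p, symmetric]
    using L2.ip_sum_left[of F g p a, OF g p] by (simp flip: p_def)
  then have "(L2_norm p)\<^sup>2 = cmod (\<Sum>n\<in>F. a n * L2_inner (g n) p)"
    by (metis norm_of_real abs_power2)
  also have "\<dots> \<le> (\<Sum>n\<in>F. cmod (a n) * cmod (analysis g p n))"
    by (rule order_trans[OF norm_sum])
       (simp add: norm_mult analysis_def L2.ip_commute[OF p g])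
  finally have "((L2_norm p)\<^sup>2)\<^sup>2 \<le> (\<Sum>n\<in>F. cmod (a n) * cmod (analysis g p n))\<^sup>2"
    by (rule power_mono) simp
  also note Cauchy_Schwarz_ineq_sum
  finally show ?thesis .
qed

lemma synthesis_bound_of_analysis_bound:
  assumes g: "\<And>n. g n \<in> L2" and p_def: "p = (\<lambda>t. \<Sum>n\<in>F. a n * g n t)" and "B \<ge> 0"
    and bound: "(\<Sum>n\<in>F. (cmod (analysis g p n))\<^sup>2) \<le> B * (L2_norm p)\<^sup>2"
  shows "(L2_norm p)\<^sup>2 \<le> B * (\<Sum>n\<in>F. (cmod (a n))\<^sup>2)"
proof (cases "L2_norm p = 0")
  case True
  then show ?thesis using \<open>B \<ge> 0\<close> by (simp add: sum_nonneg)
next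
  case False
  have "(L2_norm p)\<^sup>2 * (L2_norm p)\<^sup>2 \<le> (\<Sum>n\<in>F. (cmod (a n))\<^sup>2) * (B * (L2_norm p)\<^sup>2)"
    using square_norm_finite_combination_le[OF g p_def]
      mult_left_mono[OF bound sum_nonneg[of F "\<lambda>n. (cmod (a n))\<^sup>2"]] by (simp add: power2_eq_square)
  then have "(L2_norm p)\<^sup>2 * (L2_norm p)\<^sup>2 \<le> (B * (\<Sum>n\<in>F. (cmod (a n))\<^sup>2)) * (L2_norm p)\<^sup>2"
    by (simp only: mult_ac)
  then show ?thesis by (rule mult_right_le_imp_le) (use False in simp)
qed

text \<open>Test \<open>h\<close> against the combination \<open>p\<close> whose coefficients are \<open>\<langle>h, g\<^sub>n\<rangle>\<close> themselves:
\<open>\<langle>p, h\<rangle>\<close> is then the sum to be estimated.\<close>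

lemma analysis_bound_of_synthesis_bound:
  assumes g: "\<And>n. g n \<in> L2" and h: "h \<in> L2" and "B \<ge> 0"
    and bound: "\<And>a. (L2_norm (\<lambda>t. \<Sum>n\<in>F. a n * g n t))\<^sup>2 \<le> B * (\<Sum>n\<in>F. (cmod (a n))\<^sup>2)"
  shows "(\<Sum>n\<in>F. (cmod (analysis g h n))\<^sup>2) \<le> B * (L2_norm h)\<^sup>2"
proof -
  define p where "p = (\<lambda>t. \<Sum>n\<in>F. analysis g h n * g n t)"
  define s where "s = (\<Sum>n\<in>F. (cmod (analysis g h n))\<^sup>2)"
  have p: "p \<in> L2" unfolding p_def using g by (rule L2.sum_closed)
  have "L2_inner p h = complex_of_real s"
    unfolding p_def s_def L2.ip_sum_left[of F g h "analysis g h", OF g h] of_real_sum complex_norm_square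
    by (simp add: analysis_def L2.ip_commute[OF h g])
  then have "\<bar>s\<bar> \<le> L2_norm p * L2_norm h" using L2.Cauchy_Schwarz[OF p h] by simp
  moreover have s0: "0 \<le> s" by (simp add: s_def sum_nonneg)
  ultimately have "s\<^sup>2 \<le> (L2_norm p * L2_norm h)\<^sup>2" by (intro power_mono) auto
  also have "\<dots> \<le> (B * s) * (L2_norm h)\<^sup>2"
    using bound[of "analysis g h"] unfolding power_mult_distrib p_def[symmetric] s_def[symmetric]
    by (intro mult_right_mono) auto
  finally have "s * s \<le> (B * (L2_norm h)\<^sup>2) * s" by (simp add: power2_eq_square mult_ac)
  then have "s \<le> B * (L2_norm h)\<^sup>2"
    using s0 \<open>B \<ge> 0\<close> by (cases "s = 0") (auto simp: mult_le_cancel_right)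
  then show ?thesis by (simp add: s_def)
qed

lemma analysis_diff:
  assumes "\<And>n. g n \<in> L2" "f \<in> L2" "h \<in> L2"
  shows "analysis g (\<lambda>t. f t - h t) = (\<lambda>n. analysis g f n - analysis g h n)"
  by (simp add: analysis_def fun_eq_iff L2.ip_diff_left assms)

lemma is_frame_iff:
  "is_frame g H \<longleftrightarrow> (\<forall>n. g n \<in> H) \<and> (\<exists>A B. 0 < A \<and> A \<le> B \<and> (\<forall>h\<in>H. analysis g h \<in> ell2 \<and>
     A * (L2_norm h)\<^sup>2 \<le> (ell2_norm (analysis g h))\<^sup>2 \<and> (ell2_norm (analysis g h))\<^sup>2 \<le> B * (L2_norm h)\<^sup>2))"
  unfolding is_frame_def ell2_norm_square by (simp add: analysis_def ell2_def)

text \<open>For a finitely supported sequence the net of partial sums is eventually constant, so its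
\<open>L\<^sup>2\<close>-limit is the finite sum up to a null set.\<close>

lemma Riesz_basis_finite_bounds:
  assumes g: "\<And>n. g n \<in> L2" and F: "finite F"
    and Riesz: "\<And>c. c \<in> ell2 \<Longrightarrow> \<exists>f. L2_has_sum (\<lambda>n t. c n * g n t) f \<and>
          A * (ell2_norm c)\<^sup>2 \<le> (L2_norm f)\<^sup>2 \<and> (L2_norm f)\<^sup>2 \<le> B * (ell2_norm c)\<^sup>2"
    and p_def: "p = (\<lambda>t. \<Sum>n\<in>F. a n * g n t)"
  shows "A * (\<Sum>n\<in>F. (cmod (a n))\<^sup>2) \<le> (L2_norm p)\<^sup>2"
    and "(L2_norm p)\<^sup>2 \<le> B * (\<Sum>n\<in>F. (cmod (a n))\<^sup>2)"
proof -
  define c where "c n = (if n \<in> F then a n else 0)" for n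
  have c: "c \<in> ell2" using F by (rule ell2_finite_support) (simp add: c_def)
  have c_norm: "(ell2_norm c)\<^sup>2 = (\<Sum>n\<in>F. (cmod (a n))\<^sup>2)"
    using ell2_norm_finite_support[OF F, of c] by (simp add: c_def)
  have p: "p \<in> L2" unfolding p_def using g by (rule L2.sum_closed)
  obtain f where sum: "L2_has_sum (\<lambda>n t. c n * g n t) f"
    and f: "A * (ell2_norm c)\<^sup>2 \<le> (L2_norm f)\<^sup>2" "(L2_norm f)\<^sup>2 \<le> B * (ell2_norm c)\<^sup>2"
    using Riesz[OF c] by blast
  have fL: "f \<in> L2" and lim: "((\<lambda>G. L2_norm (\<lambda>t. (\<Sum>n\<in>G. c n * g n t) - f t)) \<longlongrightarrow> 0) (finite_subsets_at_top UNIV)"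
    using sum by (auto simp: L2_has_sum_def)
  have "(\<Sum>n\<in>G. c n * g n t) = p t" if "F \<subseteq> G" "finite G" for G t
    unfolding p_def using that by (intro sum.mono_neutral_cong_right) (auto simp: c_def)
  then have "\<forall>\<^sub>F G in finite_subsets_at_top UNIV. L2_norm (\<lambda>t. (\<Sum>n\<in>G. c n * g n t) - f t) = L2_norm (\<lambda>t. p t - f t)"
    unfolding eventually_finite_subsets_at_top using F by (intro exI[of _ F]) auto
  from Lim_transform_eventually[OF lim this] have "L2_norm (\<lambda>t. p t - f t) = 0"
    by (simp add: tendsto_const_iff)
  then have "L2_norm p = L2_norm f"
    using L2_norm_cong_AE[OF p fL] L2_norm_diff_eq_0_iff_AE[OF p fL] by blast
  with f c_norm show "A * (\<Sum>n\<in>F. (cmod (a n))\<^sup>2) \<le> (L2_norm p)\<^sup>2"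
    and "(L2_norm p)\<^sup>2 \<le> B * (\<Sum>n\<in>F. (cmod (a n))\<^sup>2)" by simp_all
qed

text \<open>The Riesz bounds for finite sums give the upper frame bound by duality, and the lower one at
finite combinations. The latter extends to the closed span by continuity of the analysis operator.\<close>

theorem Riesz_basis_imp_frame:
  assumes "is_Riesz_basis g (L2_closed_span g)"
  shows "is_frame g (L2_closed_span g)"
proof -
  have span: "\<And>n. g n \<in> L2_closed_span g" using assms by (simp add: is_Riesz_basis_def)
  then have g: "\<And>n. g n \<in> L2" by (blast intro: L2_closed_span_L2)
  obtain A B where AB: "0 < A" "A \<le> B"
    and Riesz: "\<And>c. c \<in> ell2 \<Longrightarrow> \<exists>f. L2_has_sum (\<lambda>n t. c n * g n t) f \<and>
          A * (ell2_norm c)\<^sup>2 \<le> (L2_norm f)\<^sup>2 \<and> (L2_norm f)\<^sup>2 \<le> B * (ell2_norm c)\<^sup>2"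
    using assms unfolding is_Riesz_basis_def by blast
  note bounds = Riesz_basis_finite_bounds[OF g _ Riesz refl]
  have B: "B \<ge> 0" using AB by simp
  have analysis_finite: "(\<Sum>n\<in>F. (cmod (analysis g h n))\<^sup>2) \<le> (sqrt B * L2_norm h)\<^sup>2"
    if "h \<in> L2" "finite F" for h F
    using analysis_bound_of_synthesis_bound[OF g that(1) B bounds(2)[OF that(2)]] B
    by (simp add: power_mult_distrib)
  have nn: "0 \<le> sqrt B * L2_norm h" if "h \<in> L2" for h using B L2.nrm_nonneg[OF that] by simp
  have analysis: "analysis g h \<in> ell2" "ell2_norm (analysis g h) \<le> sqrt B * L2_norm h" if "h \<in> L2" for h
    using ell2_I_bounded[OF analysis_finite[OF that] nn[OF that]] by auto
  have lower: "sqrt A * L2_norm h \<le> ell2_norm (analysis g h)" if h: "h \<in> L2_closed_span g" for h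
  proof -
    have hL: "h \<in> L2" using h by (rule L2_closed_span_L2)
    obtain F a where F: "\<And>k::nat. finite (F k)"
      and lim: "(\<lambda>k. L2_norm (\<lambda>t. h t - (\<Sum>n\<in>F k. a k n * g n t))) \<longlonglongrightarrow> 0"
      using closed_span_approximating_sequence[OF h] by blast
    define p where "p k = (\<lambda>t. \<Sum>n\<in>F k. a k n * g n t)" for k
    have p: "p k \<in> L2" for k unfolding p_def using g by (rule L2.sum_closed)
    have lim: "(\<lambda>k. L2_norm (\<lambda>t. p k t - h t)) \<longlonglongrightarrow> 0"
      using lim unfolding L2.nrm_minus_commute[OF p hL] by (simp add: p_def)
    have lower_p: "sqrt A * L2_norm (p k) \<le> ell2_norm (analysis g (p k))" for k
    proof (rule power2_le_imp_le)
      let ?X = "\<Sum>n\<in>F k. (cmod (a k n))\<^sup>2" and ?Y = "\<Sum>n\<in>F k. (cmod (analysis g (p k) n))\<^sup>2"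
      \<comment> \<open>combine \<open>\<parallel>p\<parallel>\<^sup>4 \<le> X Y\<close> with \<open>A X \<le> \<parallel>p\<parallel>\<^sup>2\<close> and cancel \<open>\<parallel>p\<parallel>\<^sup>2\<close>\<close>
      have "A * ((L2_norm (p k))\<^sup>2 * (L2_norm (p k))\<^sup>2) \<le> A * (?X * ?Y)"
        using square_norm_finite_combination_le[OF g p_def, of k] \<open>0 < A\<close>
        by (intro mult_left_mono) (auto simp: power2_eq_square)
      also have "\<dots> \<le> (L2_norm (p k))\<^sup>2 * ?Y"
      proof -
        have "A * ?X \<le> (L2_norm (p k))\<^sup>2" unfolding p_def by (rule bounds(1)[OF F])
        then show ?thesis unfolding mult.assoc[symmetric] by (rule mult_right_mono) (simp add: sum_nonneg)
      qed
      finally have "(A * (L2_norm (p k))\<^sup>2) * (L2_norm (p k))\<^sup>2 \<le> ?Y * (L2_norm (p k))\<^sup>2"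
        by (simp only: mult_ac)
      then have "A * (L2_norm (p k))\<^sup>2 \<le> ?Y"
        by (cases "L2_norm (p k) = 0") (auto simp: mult_le_cancel_right sum_nonneg)
      also have "\<dots> \<le> (ell2_norm (analysis g (p k)))\<^sup>2"
        by (intro sum_le_ell2_norm_square analysis p F)
      finally show "(sqrt A * L2_norm (p k))\<^sup>2 \<le> (ell2_norm (analysis g (p k)))\<^sup>2"
        using \<open>0 < A\<close> by (simp add: power_mult_distrib)
    qed (intro ell2.nrm_nonneg analysis p)
    have "sqrt A * L2_norm (p k) \<le> ell2_norm (analysis g h) + sqrt B * L2_norm (\<lambda>t. p k t - h t)" for k
      using lower_p[of k] ell2.nrm_triangle_sub[OF analysis(1)[OF p] analysis(1)[OF hL], of k]
        analysis(2)[OF L2.diff[OF p hL], of k] unfolding analysis_diff[OF g p hL] by linarith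
    moreover have "(\<lambda>k. sqrt A * L2_norm (p k)) \<longlonglongrightarrow> sqrt A * L2_norm h"
      by (intro tendsto_intros L2.nrm_tendsto hL p lim)
    moreover have "(\<lambda>k. ell2_norm (analysis g h) + sqrt B * L2_norm (\<lambda>t. p k t - h t))
        \<longlonglongrightarrow> ell2_norm (analysis g h) + sqrt B * 0"
      by (intro tendsto_intros lim)
    ultimately show ?thesis using LIMSEQ_le by fastforce
  qed
  show ?thesis unfolding is_frame_iff
  proof (intro conjI allI exI ballI span)
    show "0 < A" "A \<le> B" by fact+
    fix h assume h: "h \<in> L2_closed_span g"
    then have hL: "h \<in> L2" by (rule L2_closed_span_L2)
    show "analysis g h \<in> ell2" using hL by (rule analysis)
    show "A * (L2_norm h)\<^sup>2 \<le> (ell2_norm (analysis g h))\<^sup>2"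
      using power_mono[OF lower[OF h], of 2] \<open>0 < A\<close> L2.nrm_nonneg[OF hL] by (simp add: power_mult_distrib)
    show "(ell2_norm (analysis g h))\<^sup>2 \<le> B * (L2_norm h)\<^sup>2"
      using power_mono[OF analysis(2)[OF hL], of 2] B ell2.nrm_nonneg[OF analysis(1)[OF hL]] by (simp add: power_mult_distrib)
  qed
qed

section \<open>The synthesis operator of a frame\<close>

definition synthesis :: "(int \<Rightarrow> real \<Rightarrow> complex) \<Rightarrow> (int \<Rightarrow> complex) \<Rightarrow> real \<Rightarrow> complex" where
  "synthesis g d t = (\<Sum>\<^sub>\<infinity>n. d n * g n t)"

text \<open>The remainder of a sequence outside \<open>F\<close>: synthesizing it gives the error of the partial sum
over \<open>F\<close>, in every mode of convergence considered.\<close>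

definition tail :: "(int \<Rightarrow> complex) \<Rightarrow> int set \<Rightarrow> int \<Rightarrow> complex" where
  "tail d F n = (if n \<in> F then 0 else d n)"

lemma tail_ell2:
  assumes "d \<in> ell2" shows "tail d F \<in> ell2"
proof -
  have "(\<lambda>n. (cmod (tail d F n))\<^sup>2) summable_on UNIV"
    by (rule summable_on_comparison_test[OF ell2_D[OF assms]]) (auto simp: tail_def)
  then show ?thesis by (simp add: ell2_def)
qed

lemma ell2_norm_tail:
  assumes d: "d \<in> ell2" and F: "finite F"
  shows "(ell2_norm (tail d F))\<^sup>2 = (ell2_norm d)\<^sup>2 - (\<Sum>n\<in>F. (cmod (d n))\<^sup>2)"
proof -
  define c where "c n = (if n \<in> F then d n else 0)" for n
  have c: "c \<in> ell2" using F by (rule ell2_finite_support) (simp add: c_def)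
  have "(\<Sum>\<^sub>\<infinity>n. (cmod (d n))\<^sup>2) = (\<Sum>\<^sub>\<infinity>n. (cmod (c n))\<^sup>2 + (cmod (tail d F n))\<^sup>2)"
    by (rule infsum_cong) (simp add: c_def tail_def)
  also have "\<dots> = (ell2_norm c)\<^sup>2 + (ell2_norm (tail d F))\<^sup>2"
    unfolding ell2_norm_square by (intro infsum_add ell2_D c tail_ell2 d)
  also have "(ell2_norm c)\<^sup>2 = (\<Sum>n\<in>F. (cmod (d n))\<^sup>2)"
    using ell2_norm_finite_support[OF F, of c] by (simp add: c_def)
  finally show ?thesis by (simp add: ell2_norm_square)
qed

lemma ell2_norm_tail_tendsto:
  assumes d: "d \<in> ell2"
  shows "((\<lambda>F. ell2_norm (tail d F)) \<longlongrightarrow> 0) (finite_subsets_at_top UNIV)"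
proof -
  have "((\<lambda>F. (ell2_norm d)\<^sup>2 - (\<Sum>n\<in>F. (cmod (d n))\<^sup>2)) \<longlongrightarrow> (ell2_norm d)\<^sup>2 - (ell2_norm d)\<^sup>2)
      (finite_subsets_at_top UNIV)"
    using infsum_tendsto[OF ell2_D[OF d]] unfolding ell2_norm_square by (intro tendsto_intros)
  then have "((\<lambda>F. sqrt ((ell2_norm d)\<^sup>2 - (\<Sum>n\<in>F. (cmod (d n))\<^sup>2))) \<longlongrightarrow> sqrt 0)
      (finite_subsets_at_top UNIV)"
    by (intro tendsto_real_sqrt) simp
  moreover have "\<forall>\<^sub>F F in finite_subsets_at_top UNIV.
      sqrt ((ell2_norm d)\<^sup>2 - (\<Sum>n\<in>F. (cmod (d n))\<^sup>2)) = ell2_norm (tail d F)"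
    unfolding eventually_finite_subsets_at_top using ell2.nrm_nonneg[OF tail_ell2[OF d]]
    by (intro exI[of _ "{}"]) (simp flip: ell2_norm_tail[OF d])
  ultimately have "((\<lambda>F. ell2_norm (tail d F)) \<longlongrightarrow> sqrt 0) (finite_subsets_at_top UNIV)"
    by (rule Lim_transform_eventually)
  then show ?thesis by simp
qed

lemma synthesis_has_sum:
  assumes "d \<in> ell2" "(\<lambda>n. g n t) \<in> ell2"
  shows "((\<lambda>n. d n * g n t) has_sum synthesis g d t) UNIV"
  unfolding synthesis_def
  by (rule has_sum_infsum[OF abs_summable_summable[OF ell2_mult_abs_summable[OF assms]]])

lemma cmod_synthesis_le:
  assumes "d \<in> ell2" "(\<lambda>n. g n t) \<in> ell2"
  shows "cmod (synthesis g d t) \<le> ell2_norm d * ell2_norm (\<lambda>n. g n t)"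
proof -
  have "synthesis g d t = ell2_inner d (\<lambda>n. cnj (g n t))"
    by (simp add: synthesis_def ell2_inner_def)
  moreover have "ell2_norm (\<lambda>n. cnj (g n t)) = ell2_norm (\<lambda>n. g n t)" by (simp add: ell2_norm_def)
  ultimately show ?thesis using ell2.Cauchy_Schwarz[OF assms(1), of "\<lambda>n. cnj (g n t)"] assms(2)
    by (simp add: ell2_cnj_iff)
qed

lemma synthesis_add:
  assumes "c \<in> ell2" "d \<in> ell2" "(\<lambda>n. g n t) \<in> ell2"
  shows "synthesis g (\<lambda>n. c n + d n) t = synthesis g c t + synthesis g d t"
  unfolding synthesis_def distrib_right
  using synthesis_has_sum assms by (intro infsum_add has_sum_imp_summable)

lemma synthesis_scale: "synthesis g (\<lambda>n. a * d n) t = a * synthesis g d t"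
  by (simp add: synthesis_def mult.assoc infsum_cmult_right')

lemma synthesis_diff:
  assumes "c \<in> ell2" "d \<in> ell2" "(\<lambda>n. g n t) \<in> ell2"
  shows "synthesis g (\<lambda>n. c n - d n) t = synthesis g c t - synthesis g d t"
  using synthesis_add[where g = g and t = t, OF assms(1) ell2_scale[OF assms(2), of "-1"] assms(3)]
    synthesis_scale[of g "-1" d t] by simp

lemma synthesis_tail:
  assumes d: "d \<in> ell2" and F: "finite F" and g: "(\<lambda>n. g n t) \<in> ell2"
  shows "synthesis g (tail d F) t = synthesis g d t - (\<Sum>n\<in>F. d n * g n t)"
proof -
  define c where "c n = (if n \<in> F then d n else 0)" for n
  have c: "c \<in> ell2" using F by (rule ell2_finite_support) (simp add: c_def)
  have "synthesis g c t = (\<Sum>n\<in>F. d n * g n t)"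
  proof -
    have "(\<Sum>\<^sub>\<infinity>n. c n * g n t) = (\<Sum>\<^sub>\<infinity>n\<in>F. d n * g n t)"
      by (rule infsum_cong_neutral) (auto simp: c_def)
    then show ?thesis using F by (simp add: synthesis_def)
  qed
  moreover have "synthesis g (\<lambda>n. d n - c n) t = synthesis g (tail d F) t"
    unfolding synthesis_def by (rule infsum_cong) (simp add: c_def tail_def)
  ultimately show ?thesis using synthesis_diff[where g = g and t = t, OF d c g] by simp
qed

text \<open>The setting common to all three parts: square-summable values at each point make the synthesis
series converge pointwise, the frame bounds make it converge in \<open>L\<^sup>2\<close>.\<close>

locale pointwise_frame =
  fixes g :: "int \<Rightarrow> real \<Rightarrow> complex" and A B :: real
  assumes span: "g n \<in> L2_closed_span g"
    and A_pos: "0 < A" and A_le_B: "A \<le> B"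
    and analysis_ell2: "h \<in> L2_closed_span g \<Longrightarrow> analysis g h \<in> ell2"
    and lower_bound: "h \<in> L2_closed_span g \<Longrightarrow> A * (L2_norm h)\<^sup>2 \<le> (ell2_norm (analysis g h))\<^sup>2"
    and upper_bound: "h \<in> L2_closed_span g \<Longrightarrow> (ell2_norm (analysis g h))\<^sup>2 \<le> B * (L2_norm h)\<^sup>2"
    and pointwise: "(\<lambda>n. g n t) \<in> ell2"
begin

abbreviation V where "V \<equiv> L2_closed_span g"
abbreviation S where "S \<equiv> synthesis g"

definition N where "N = {d \<in> ell2. AE t in lebesgue. S d t = 0}"

definition N_perp where "N_perp = ell2_orthogonal N"

lemma V_L2: "f \<in> V \<Longrightarrow> f \<in> L2" by (rule L2_closed_span_L2)

lemma g_L2: "g n \<in> L2" using span by (rule V_L2)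

lemma B_pos: "0 < B" using A_pos A_le_B by simp

lemma V_add: "f \<in> V \<Longrightarrow> h \<in> V \<Longrightarrow> (\<lambda>t. f t + h t) \<in> V"
  by (rule closed_span_add[OF g_L2])

lemma V_scale: "f \<in> V \<Longrightarrow> (\<lambda>t. a * f t) \<in> V"
  by (rule closed_span_scale[OF g_L2])

lemma V_diff: "f \<in> V \<Longrightarrow> h \<in> V \<Longrightarrow> (\<lambda>t. f t - h t) \<in> V"
  using V_add[OF _ V_scale[of h "-1"], of f] by simp

text \<open>The upper frame bound bounds the analysis operator by \<open>\<surd>B\<close>, hence also its adjoint.\<close>

lemma S_finite_bound:
  assumes "finite F"
  shows "(L2_norm (\<lambda>t. \<Sum>n\<in>F. a n * g n t))\<^sup>2 \<le> B * (\<Sum>n\<in>F. (cmod (a n))\<^sup>2)"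
proof (rule synthesis_bound_of_analysis_bound[OF g_L2 refl])
  let ?p = "\<lambda>t. \<Sum>n\<in>F. a n * g n t"
  have p: "?p \<in> V" using g_L2 assms by (rule finite_combination_in_closed_span)
  show "(\<Sum>n\<in>F. (cmod (analysis g ?p n))\<^sup>2) \<le> B * (L2_norm ?p)\<^sup>2"
    using sum_le_ell2_norm_square[OF analysis_ell2[OF p] assms] upper_bound[OF p] by linarith
qed (use B_pos in simp)

text \<open>Fatou's lemma applied to the symmetric partial sums over \<open>{-k..k}\<close>, which converge pointwise
to \<open>S d\<close> and are uniformly bounded in \<open>L\<^sup>2\<close>.\<close>

lemma S_bounded:
  assumes d: "d \<in> ell2"
  shows "S d \<in> L2" and "L2_norm (S d) \<le> sqrt B * ell2_norm d"
proof -
  define s where "s k = (\<lambda>t. \<Sum>n\<in>{- int k..int k}. d n * g n t)" for k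
  have s: "s k \<in> L2" for k unfolding s_def using g_L2 by (rule L2.sum_closed)
  have "filterlim (\<lambda>k. {- int k..int k}) (finite_subsets_at_top UNIV) sequentially"
    unfolding filterlim_iff eventually_finite_subsets_at_top
  proof (intro allI impI, elim exE conjE)
    fix P and X :: "int set"
    assume X: "finite X" and P: "\<forall>Y. finite Y \<and> X \<subseteq> Y \<and> Y \<subseteq> UNIV \<longrightarrow> P Y"
    define K where "K = Max (insert 0 ((nat \<circ> abs) ` X))"
    have "nat \<bar>x\<bar> \<le> K" if "x \<in> X" for x unfolding K_def using X that by (auto intro: Max_ge)
    then have "X \<subseteq> {- int k..int k}" if "k \<ge> K" for k using that by fastforce
    then show "\<forall>\<^sub>F k in sequentially. P {- int k..int k}"
      unfolding eventually_sequentially using P by (intro exI[of _ K]) simp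
  qed
  from filterlim_compose[OF _ this] have lim: "(\<lambda>k. s k t) \<longlonglongrightarrow> S d t" for t
    using synthesis_has_sum[where g = g and t = t, OF d pointwise] unfolding has_sum_def s_def by blast
  have "L2_norm (s k) \<le> sqrt B * ell2_norm d" for k
  proof (rule power2_le_imp_le)
    have "(L2_norm (s k))\<^sup>2 \<le> B * (\<Sum>n\<in>{- int k..int k}. (cmod (d n))\<^sup>2)"
      unfolding s_def by (rule S_finite_bound) simp
    also have "\<dots> \<le> B * (ell2_norm d)\<^sup>2"
      using B_pos sum_le_ell2_norm_square[OF d] by simp
    finally show "(L2_norm (s k))\<^sup>2 \<le> (sqrt B * ell2_norm d)\<^sup>2"
      using B_pos by (simp add: power_mult_distrib)
  qed (use B_pos ell2.nrm_nonneg[OF d] in simp)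
  from L2_Fatou[OF s lim this] show "S d \<in> L2" and "L2_norm (S d) \<le> sqrt B * ell2_norm d" by auto
qed

lemma S_tail:
  assumes "d \<in> ell2" "finite F" shows "S (tail d F) = (\<lambda>t. S d t - (\<Sum>n\<in>F. d n * g n t))"
  using synthesis_tail[where g = g, OF assms pointwise] by (rule ext)

lemma S_partial_sums_tendsto:
  assumes d: "d \<in> ell2"
  shows "((\<lambda>F. L2_norm (\<lambda>t. (\<Sum>n\<in>F. d n * g n t) - S d t)) \<longlongrightarrow> 0) (finite_subsets_at_top UNIV)"
proof (rule Lim_null_comparison)
  show "((\<lambda>F. sqrt B * ell2_norm (tail d F)) \<longlongrightarrow> 0) (finite_subsets_at_top UNIV)"
    by (intro tendsto_mult_right_zero ell2_norm_tail_tendsto d)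
  have "L2_norm (\<lambda>t. (\<Sum>n\<in>F. d n * g n t) - S d t) \<le> sqrt B * ell2_norm (tail d F)" if "finite F" for F
  proof -
    have "L2_norm (\<lambda>t. (\<Sum>n\<in>F. d n * g n t) - S d t) = L2_norm (S (tail d F))"
      unfolding L2.nrm_minus_commute[OF L2.sum_closed[of F g d, OF g_L2] S_bounded(1)[OF d]]
      by (simp only: S_tail[OF d that])
    then show ?thesis using S_bounded(2)[OF tail_ell2[OF d]] by simp
  qed
  then show "\<forall>\<^sub>F F in finite_subsets_at_top UNIV.
      norm (L2_norm (\<lambda>t. (\<Sum>n\<in>F. d n * g n t) - S d t)) \<le> sqrt B * ell2_norm (tail d F)"
    unfolding eventually_finite_subsets_at_top by (intro exI[of _ "{}"]) (simp add: L2_norm_def)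
qed

lemma S_L2_has_sum:
  assumes d: "d \<in> ell2" shows "L2_has_sum (\<lambda>n t. d n * g n t) (S d)"
  unfolding L2_has_sum_def using S_partial_sums_tendsto[OF d] S_bounded(1)[OF d] L2.scale[OF g_L2] by blast

lemma S_in_V:
  assumes d: "d \<in> ell2" shows "S d \<in> V"
  unfolding L2_closed_span_def
proof (intro CollectI conjI allI impI S_bounded(1) d)
  fix e :: real assume "e > 0"
  then have "\<forall>\<^sub>F F in finite_subsets_at_top UNIV. L2_norm (\<lambda>t. (\<Sum>n\<in>F. d n * g n t) - S d t) < e"
    using order_tendstoD(2)[OF S_partial_sums_tendsto[OF d]] by blast
  then obtain F where "finite F" "L2_norm (\<lambda>t. (\<Sum>n\<in>F. d n * g n t) - S d t) < e"
    unfolding eventually_finite_subsets_at_top by blast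
  then show "\<exists>F a. finite F \<and> L2_norm (\<lambda>t. S d t - (\<Sum>n\<in>F. a n * g n t)) < e"
    unfolding L2.nrm_minus_commute[OF L2.sum_closed[of F g d, OF g_L2] S_bounded(1)[OF d]]
    by (intro exI[of _ F] exI[of _ d] conjI)
qed

lemma S_add: "c \<in> ell2 \<Longrightarrow> d \<in> ell2 \<Longrightarrow> S (\<lambda>n. c n + d n) = (\<lambda>t. S c t + S d t)"
  using synthesis_add pointwise by blast

lemma S_scale: "S (\<lambda>n. a * d n) = (\<lambda>t. a * S d t)"
  using synthesis_scale by blast

lemma S_diff: "c \<in> ell2 \<Longrightarrow> d \<in> ell2 \<Longrightarrow> S (\<lambda>n. c n - d n) = (\<lambda>t. S c t - S d t)"
  using synthesis_diff pointwise by blast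

text \<open>Both sides are limits of the same finite sums, by \<open>L\<^sup>2\<close>-convergence on the left.\<close>

lemma adjoint:
  assumes d: "d \<in> ell2" and h: "h \<in> V"
  shows "L2_inner (S d) h = ell2_inner d (analysis g h)"
proof (rule tendsto_unique)
  show "((\<lambda>F. L2_inner (\<lambda>t. \<Sum>n\<in>F. d n * g n t) h) \<longlongrightarrow> L2_inner (S d) h) (finite_subsets_at_top UNIV)"
    by (rule L2.ip_tendsto[OF S_bounded(1)[OF d] L2.sum_closed V_L2[OF h] S_partial_sums_tendsto[OF d]])
       (rule g_L2)
  have "((\<lambda>n. d n * cnj (analysis g h n)) has_sum ell2_inner d (analysis g h)) UNIV"
    unfolding ell2_inner_def by (intro has_sum_infsum ell2_mult_summable d analysis_ell2 h)
  moreover have "L2_inner (\<lambda>t. \<Sum>n\<in>F. d n * g n t) h = (\<Sum>n\<in>F. d n * cnj (analysis g h n))" for F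
    unfolding L2.ip_sum_left[of F g h d, OF g_L2 V_L2[OF h]]
    by (simp add: analysis_def L2.ip_commute[OF V_L2[OF h] g_L2])
  ultimately show "((\<lambda>F. L2_inner (\<lambda>t. \<Sum>n\<in>F. d n * g n t) h) \<longlongrightarrow> ell2_inner d (analysis g h)) (finite_subsets_at_top UNIV)"
    by (simp add: has_sum_def)
qed simp

lemma N_perp_ell2: "d \<in> N_perp \<Longrightarrow> d \<in> ell2"
  by (simp add: N_perp_def ell2_orthogonal_def)

lemma N_perp_D: "c \<in> N_perp \<Longrightarrow> d \<in> N \<Longrightarrow> ell2_inner c d = 0"
  by (simp add: N_perp_def ell2_orthogonal_def)

lemma N_perp_I: "c \<in> ell2 \<Longrightarrow> (\<And>d. d \<in> N \<Longrightarrow> ell2_inner c d = 0) \<Longrightarrow> c \<in> N_perp"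
  by (simp add: N_perp_def ell2_orthogonal_def)

lemma N_ell2: "d \<in> N \<Longrightarrow> d \<in> ell2" by (simp add: N_def)

lemma N_perp_zero: "(\<lambda>n. 0) \<in> N_perp"
  by (rule N_perp_I) (auto simp: ell2_inner_def intro: ell2_zero)

lemma N_perp_add: "c \<in> N_perp \<Longrightarrow> d \<in> N_perp \<Longrightarrow> (\<lambda>n. c n + d n) \<in> N_perp"
  by (rule N_perp_I) (simp_all add: ell2_add N_perp_ell2 N_ell2 N_perp_D ell2.ip_add)

lemma N_perp_scale: "d \<in> N_perp \<Longrightarrow> (\<lambda>n. a * d n) \<in> N_perp"
  by (rule N_perp_I) (simp_all add: ell2_scale N_perp_ell2 N_ell2 N_perp_D ell2.ip_scale)

lemma N_perp_diff: "c \<in> N_perp \<Longrightarrow> d \<in> N_perp \<Longrightarrow> (\<lambda>n. c n - d n) \<in> N_perp"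
  by (rule N_perp_I) (simp_all add: ell2.diff N_perp_ell2 N_ell2 N_perp_D ell2.ip_diff_left)

lemma N_perp_closed:
  assumes s: "\<And>k::nat. s k \<in> N_perp" and d: "d \<in> ell2" and lim: "(\<lambda>k. ell2_norm (\<lambda>n. s k n - d n)) \<longlonglongrightarrow> 0"
  shows "d \<in> N_perp"
proof (rule N_perp_I[OF d])
  fix c assume c: "c \<in> N"
  have "(\<lambda>k. ell2_inner (s k) c) \<longlonglongrightarrow> ell2_inner d c"
    by (rule ell2.ip_tendsto[OF d N_perp_ell2[OF s] N_ell2[OF c] lim])
  then show "ell2_inner d c = 0" by (simp add: N_perp_D[OF s c] LIMSEQ_const_iff)
qed

lemma analysis_in_N_perp:
  assumes h: "h \<in> V" shows "analysis g h \<in> N_perp"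
proof (rule N_perp_I[OF analysis_ell2[OF h]])
  fix d assume d: "d \<in> N"
  have "L2_norm (S d) = 0"
    using d L2_norm_eq_0_iff_AE[OF S_bounded(1)[OF N_ell2[OF d]]] by (simp add: N_def)
  then have "L2_inner (S d) h = 0"
    using L2.Cauchy_Schwarz[OF S_bounded(1)[OF N_ell2[OF d]] V_L2[OF h]] by simp
  then show "ell2_inner (analysis g h) d = 0"
    using ell2.ip_commute[OF N_ell2[OF d] analysis_ell2[OF h]] by (simp add: adjoint[OF N_ell2[OF d] h])
qed

text \<open>The difference of the two sequences lies in \<open>N\<close> and is orthogonal to \<open>N\<close>.\<close>

lemma S_inj_on_N_perp:
  assumes "c \<in> N_perp" "d \<in> N_perp" "AE t in lebesgue. S c t = S d t"
  shows "c = d"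
proof -
  define b where "b = (\<lambda>n. c n - d n)"
  have b: "b \<in> N_perp" unfolding b_def by (intro N_perp_diff assms)
  have "AE t in lebesgue. S b t = 0"
    using assms(3) unfolding b_def S_diff[OF assms(1,2)[THEN N_perp_ell2]] by eventually_elim simp
  then have "b \<in> N" using N_perp_ell2[OF b] by (simp add: N_def)
  then have "ell2_inner b b = 0" using N_perp_D b by blast
  then have "ell2_norm b = 0" using ell2.ip_self[OF N_perp_ell2[OF b]] by simp
  then have "b = (\<lambda>n. 0)" using ell2_norm_eq_0[OF N_perp_ell2[OF b]] by blast
  then show ?thesis by (simp add: b_def fun_eq_iff)
qed

lemma inner_frame_operator:
  assumes h: "h \<in> V" shows "L2_inner (S (analysis g h)) h = complex_of_real ((ell2_norm (analysis g h))\<^sup>2)"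
  unfolding adjoint[OF analysis_ell2[OF h] h] by (rule ell2.ip_self[OF analysis_ell2[OF h]])

text \<open>For \<open>d = S\<^sup>* h\<close> we have \<open>\<parallel>d\<parallel>\<^sup>2 = \<langle>S d, h\<rangle> \<le> \<parallel>S d\<parallel> \<parallel>h\<parallel>\<close>, and \<open>\<surd>A \<parallel>h\<parallel> \<le> \<parallel>d\<parallel>\<close> by the lower
frame bound.\<close>

lemma S_lower_bound_on_analysis:
  assumes h: "h \<in> V"
  shows "sqrt A * ell2_norm (analysis g h) \<le> L2_norm (S (analysis g h))"
proof -
  let ?d = "analysis g h"
  have d: "?d \<in> ell2" using h by (rule analysis_ell2)
  have nn: "0 \<le> ell2_norm ?d" "0 \<le> L2_norm h" "0 \<le> L2_norm (S ?d)"
    using ell2.nrm_nonneg[OF d] L2.nrm_nonneg[OF V_L2[OF h]] L2.nrm_nonneg[OF S_bounded(1)[OF d]] by auto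
  have lower: "sqrt A * L2_norm h \<le> ell2_norm ?d"
    by (rule power2_le_imp_le) (use lower_bound[OF h] A_pos nn in \<open>simp_all add: power_mult_distrib\<close>)
  have "(ell2_norm ?d)\<^sup>2 \<le> L2_norm (S ?d) * L2_norm h"
    using L2.Cauchy_Schwarz[OF S_bounded(1)[OF d] V_L2[OF h]]
    unfolding inner_frame_operator[OF h] norm_of_real by simp
  then have "sqrt A * (ell2_norm ?d)\<^sup>2 \<le> L2_norm (S ?d) * (sqrt A * L2_norm h)"
    using A_pos by (simp add: mult.left_commute)
  also have "\<dots> \<le> L2_norm (S ?d) * ell2_norm ?d" using lower nn by (intro mult_left_mono)
  finally have "(sqrt A * ell2_norm ?d) * ell2_norm ?d \<le> L2_norm (S ?d) * ell2_norm ?d"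
    by (simp add: power2_eq_square mult.assoc)
  then show ?thesis using nn by (cases "ell2_norm ?d = 0") (auto simp: mult_le_cancel_right)
qed

text \<open>Expanding the square, the cross term is \<open>-2 \<parallel>S\<^sup>* r\<parallel>\<^sup>2 / B\<close>, half of which is spent on
\<open>\<parallel>S S\<^sup>* r\<parallel>\<^sup>2 / B\<^sup>2 \<le> \<parallel>S\<^sup>* r\<parallel>\<^sup>2 / B\<close>. The other half gains the factor \<open>1 - A / B\<close> by the lower frame bound.\<close>

lemma frame_algorithm_contraction:
  assumes r: "r \<in> V"
  shows "(L2_norm (\<lambda>t. r t - 1 / complex_of_real B * S (analysis g r) t))\<^sup>2 \<le> (1 - A / B) * (L2_norm r)\<^sup>2"
proof -
  let ?q = "S (analysis g r)" and ?b = "complex_of_real (1 / B)"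
  have rL: "r \<in> L2" using r by (rule V_L2)
  have d: "analysis g r \<in> ell2" using r by (rule analysis_ell2)
  have qL: "?q \<in> L2" using d by (rule S_bounded)
  have bq: "(\<lambda>t. ?b * ?q t) \<in> L2" using qL by (rule L2.scale)
  have "Re (L2_inner r (\<lambda>t. ?b * ?q t)) = (ell2_norm (analysis g r))\<^sup>2 / B"
    unfolding L2.ip_scale_right[OF qL rL] L2.ip_commute[OF qL rL] inner_frame_operator[OF r] by simp
  then have "(L2_norm (\<lambda>t. r t - ?b * ?q t))\<^sup>2 =
      (L2_norm r)\<^sup>2 + (L2_norm ?q)\<^sup>2 / B\<^sup>2 - 2 * ((ell2_norm (analysis g r))\<^sup>2 / B)"
    unfolding L2.nrm_diff_square[OF rL bq] L2.nrm_scale[OF qL] by (simp add: power_mult_distrib power_divide norm_divide)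
  also have "(L2_norm ?q)\<^sup>2 / B\<^sup>2 \<le> (ell2_norm (analysis g r))\<^sup>2 / B"
  proof -
    have "(L2_norm ?q)\<^sup>2 \<le> (sqrt B * ell2_norm (analysis g r))\<^sup>2"
      by (intro power_mono S_bounded d L2.nrm_nonneg qL)
    then have "(L2_norm ?q)\<^sup>2 \<le> B * (ell2_norm (analysis g r))\<^sup>2" using B_pos by (simp add: power_mult_distrib)
    then show ?thesis using B_pos by (simp add: field_simps power2_eq_square)
  qed
  also have "(L2_norm r)\<^sup>2 + (ell2_norm (analysis g r))\<^sup>2 / B - 2 * ((ell2_norm (analysis g r))\<^sup>2 / B)
      = (L2_norm r)\<^sup>2 - (ell2_norm (analysis g r))\<^sup>2 / B" by simp
  also have "\<dots> \<le> (L2_norm r)\<^sup>2 - A * (L2_norm r)\<^sup>2 / B"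
    using lower_bound[OF r] B_pos by (simp add: divide_right_mono)
  finally show ?thesis by (simp add: left_diff_distrib)
qed

text \<open>The frame algorithm. The iterates \<open>h k\<close> need not be known to converge: what converges are
their analysis sequences \<open>D k\<close>, since \<open>S\<close> is bounded below on them and \<open>f - S (D k)\<close>
tends to zero geometrically.\<close>

theorem exists_N_perp_coefficients:
  assumes f: "f \<in> V"
  shows "\<exists>e\<in>N_perp. (AE t in lebesgue. f t = S e t) \<and> sqrt A * ell2_norm e \<le> L2_norm f"
proof -
  have fL: "f \<in> L2" using f by (rule V_L2)
  define h where "h = rec_nat (\<lambda>t. 0) (\<lambda>_ u t. u t + 1 / complex_of_real B * (f t - S (analysis g u) t))"
  define D where "D k = analysis g (h k)" for k
  define r where "r k = (\<lambda>t. f t - S (D k) t)" for k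
  have h0: "h 0 = (\<lambda>t. 0)" by (simp add: h_def)
  have hSuc: "h (Suc k) = (\<lambda>t. h k t + 1 / complex_of_real B * r k t)" for k
    by (simp add: h_def r_def D_def)
  have h: "h k \<in> V" for k
  proof (induction k)
    case 0 show ?case unfolding h0 using V_scale[OF f, of 0] by simp
  next
    case (Suc k)
    then show ?case unfolding hSuc r_def D_def by (intro V_add V_scale V_diff f S_in_V analysis_ell2)
  qed
  have D: "D k \<in> ell2" "D k \<in> N_perp" for k unfolding D_def by (intro analysis_ell2 analysis_in_N_perp h)+
  have SD: "S (D k) \<in> L2" for k by (intro S_bounded D)
  have r: "r k \<in> V" for k unfolding r_def by (intro V_diff f S_in_V D)
  have r_Suc: "r (Suc k) = (\<lambda>t. r k t - 1 / complex_of_real B * S (analysis g (r k)) t)" for k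
  proof -
    have "D (Suc k) = (\<lambda>n. D k n + 1 / complex_of_real B * analysis g (r k) n)"
      unfolding D_def hSuc analysis_def
      by (simp only: L2.ip_add[OF V_L2[OF h] L2.scale[OF V_L2[OF r]] g_L2] L2.ip_scale[OF V_L2[OF r] g_L2])
    then have "S (D (Suc k)) = (\<lambda>t. S (D k) t + 1 / complex_of_real B * S (analysis g (r k)) t)"
      by (simp only: S_add[OF D(1) ell2_scale[OF analysis_ell2[OF r]]] S_scale)
    then show ?thesis
      unfolding r_def[of "Suc k"] by (simp only: diff_diff_add[symmetric] r_def[symmetric, THEN fun_cong])
  qed
  have q: "0 \<le> 1 - A / B" "1 - A / B < 1" using A_pos A_le_B by auto
  have r_bound: "(L2_norm (r k))\<^sup>2 \<le> (1 - A / B) ^ k * (L2_norm (r 0))\<^sup>2" for k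
  proof (induction k)
    case (Suc k)
    have "(L2_norm (r (Suc k)))\<^sup>2 \<le> (1 - A / B) * (L2_norm (r k))\<^sup>2"
      unfolding r_Suc by (rule frame_algorithm_contraction[OF r])
    also have "\<dots> \<le> (1 - A / B) * ((1 - A / B) ^ k * (L2_norm (r 0))\<^sup>2)"
      by (intro mult_left_mono Suc q)
    finally show ?case by (simp add: mult.assoc)
  qed simp
  have "(\<lambda>k. (1 - A / B) ^ k * (L2_norm (r 0))\<^sup>2) \<longlonglongrightarrow> 0"
    using q by (intro tendsto_mult_left_zero LIMSEQ_power_zero) simp
  then have "(\<lambda>k. (L2_norm (r k))\<^sup>2) \<longlonglongrightarrow> 0"
    by (rule Lim_null_comparison[rotated]) (use r_bound in simp)
  then have "(\<lambda>k. sqrt ((L2_norm (r k))\<^sup>2)) \<longlonglongrightarrow> sqrt 0" by (rule tendsto_real_sqrt)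
  then have r_lim: "(\<lambda>k. L2_norm (r k)) \<longlonglongrightarrow> 0" using L2.nrm_nonneg[OF V_L2[OF r]] by simp
  have D_diff: "sqrt A * ell2_norm (\<lambda>n. D j n - D k n) \<le> L2_norm (r j) + L2_norm (r k)" for j k
  proof -
    have "(\<lambda>n. D j n - D k n) = analysis g (\<lambda>t. h j t - h k t)"
      unfolding D_def by (rule analysis_diff[OF g_L2 V_L2[OF h] V_L2[OF h], symmetric])
    then have "sqrt A * ell2_norm (\<lambda>n. D j n - D k n) \<le> L2_norm (S (\<lambda>n. D j n - D k n))"
      using S_lower_bound_on_analysis[OF V_diff[OF h h]] by simp
    also have "\<dots> \<le> L2_norm (\<lambda>t. S (D j) t - f t) + L2_norm (\<lambda>t. f t - S (D k) t)"
      unfolding S_diff[OF D(1) D(1)] by (rule L2.nrm_triangle_diff[OF SD fL SD])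
    finally show ?thesis unfolding L2.nrm_minus_commute[OF SD fL] r_def .
  qed
  have "\<exists>e\<in>ell2. (\<lambda>k. ell2_norm (\<lambda>n. D k n - e n)) \<longlonglongrightarrow> 0"
  proof (rule ell2_complete[OF D(1)])
    fix e :: real assume "e > 0"
    then have "sqrt A * e / 2 > 0" using A_pos by simp
    then obtain N where N: "\<And>k. k \<ge> N \<Longrightarrow> L2_norm (r k) < sqrt A * e / 2"
      using order_tendstoD(2)[OF r_lim] unfolding eventually_sequentially by blast
    have "sqrt A * ell2_norm (\<lambda>n. D j n - D k n) < sqrt A * e" if "j \<ge> N" "k \<ge> N" for j k
      using D_diff[of j k] N[OF that(1)] N[OF that(2)] by linarith
    then show "\<exists>N. \<forall>j\<ge>N. \<forall>k\<ge>N. ell2_norm (\<lambda>n. D j n - D k n) < e"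
      using A_pos by (intro exI[of _ N]) simp
  qed
  then obtain e where e: "e \<in> ell2" and D_lim: "(\<lambda>k. ell2_norm (\<lambda>n. D k n - e n)) \<longlonglongrightarrow> 0" by blast
  have eN: "e \<in> N_perp" by (rule N_perp_closed[OF D(2) e D_lim])
  have Se: "S e \<in> L2" using e by (rule S_bounded)
  have SD_lim: "(\<lambda>k. L2_norm (\<lambda>t. S (D k) t - S e t)) \<longlonglongrightarrow> 0"
  proof (rule Lim_null_comparison)
    show "(\<lambda>k. sqrt B * ell2_norm (\<lambda>n. D k n - e n)) \<longlonglongrightarrow> 0" by (intro tendsto_mult_right_zero D_lim)
    show "\<forall>\<^sub>F k in sequentially. norm (L2_norm (\<lambda>t. S (D k) t - S e t)) \<le> sqrt B * ell2_norm (\<lambda>n. D k n - e n)"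
      using S_bounded(2)[OF ell2.diff[OF D(1) e]] L2.nrm_nonneg[OF L2.diff[OF SD Se]]
      by (simp add: S_diff[OF D(1) e])
  qed
  have "L2_norm (\<lambda>t. f t - S e t) \<le> 0 + 0"
  proof (rule LIMSEQ_le_const[OF tendsto_add[OF r_lim SD_lim]])
    show "\<exists>N. \<forall>k\<ge>N. L2_norm (\<lambda>t. f t - S e t) \<le> L2_norm (r k) + L2_norm (\<lambda>t. S (D k) t - S e t)"
      unfolding r_def using L2.nrm_triangle_diff[OF fL SD Se] by blast
  qed
  then have "L2_norm (\<lambda>t. f t - S e t) = 0" using L2.nrm_nonneg[OF L2.diff[OF fL Se]] by simp
  then have ae: "AE t in lebesgue. f t = S e t" using L2_norm_diff_eq_0_iff_AE[OF fL Se] by simp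
  have "sqrt A * ell2_norm e \<le> L2_norm (S e)"
  proof (rule LIMSEQ_le)
    show "(\<lambda>k. sqrt A * ell2_norm (D k)) \<longlonglongrightarrow> sqrt A * ell2_norm e"
      by (intro tendsto_intros ell2.nrm_tendsto e D D_lim)
    show "(\<lambda>k. L2_norm (S (D k))) \<longlonglongrightarrow> L2_norm (S e)"
      by (intro L2.nrm_tendsto Se SD SD_lim)
    show "\<exists>N. \<forall>k\<ge>N. sqrt A * ell2_norm (D k) \<le> L2_norm (S (D k))"
      unfolding D_def using S_lower_bound_on_analysis[OF h] by blast
  qed
  with ae eN show ?thesis using L2_norm_cong_AE[OF fL Se ae] by auto
qed

text \<open>By injectivity modulo null sets, the coefficients with the norm bound that exist for \<open>S d\<close>
must be \<open>d\<close> itself.\<close>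

lemma S_lower_bound_on_N_perp:
  assumes d: "d \<in> N_perp" shows "sqrt A * ell2_norm d \<le> L2_norm (S d)"
proof -
  obtain e where "e \<in> N_perp" "AE t in lebesgue. S d t = S e t" "sqrt A * ell2_norm e \<le> L2_norm (S d)"
    using exists_N_perp_coefficients[OF S_in_V[OF N_perp_ell2[OF d]]] by blast
  then show ?thesis using S_inj_on_N_perp[OF d] by metis
qed

theorem represents_V: "represents_classes (S ` N_perp) V"
  unfolding represents_classes_def
proof (intro conjI ballI ex_ex1I)
  show "S ` N_perp \<subseteq> V" using S_in_V N_perp_ell2 by blast
  fix f assume f: "f \<in> V"
  show "\<exists>u. u \<in> S ` N_perp \<and> (AE t in lebesgue. f t = u t)"
    using exists_N_perp_coefficients[OF f] by blast
  fix u v assume "u \<in> S ` N_perp \<and> (AE t in lebesgue. f t = u t)" "v \<in> S ` N_perp \<and> (AE t in lebesgue. f t = v t)"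
  then obtain c d where cd: "c \<in> N_perp" "d \<in> N_perp" "u = S c" "v = S d"
    and "AE t in lebesgue. f t = S c t" "AE t in lebesgue. f t = S d t" by blast
  from this(5,6) have "AE t in lebesgue. S c t = S d t" by eventually_elim simp
  with cd show "u = v" using S_inj_on_N_perp by metis
qed

text \<open>Since \<open>S\<close> is bounded and bounded below on \<open>N\<^sup>\<bottom>\<close>, completeness carries over from the closed
subspace \<open>N\<^sup>\<bottom>\<close> of \<open>\<ell>\<^sup>2\<close>, and a bound on point evaluations in terms of coefficients becomes one in terms
of the \<open>L\<^sup>2\<close>-norm.\<close>

theorem reproducing_kernel: "reproducing_kernel_Hilbert_space (S ` N_perp) L2_inner"
proof -
  have W: "S d \<in> L2" if "d \<in> N_perp" for d using that by (intro S_bounded N_perp_ell2)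
  have S_zero: "S (\<lambda>n. 0) = (\<lambda>t. 0)" by (simp add: synthesis_def fun_eq_iff)
  interpret W: function_Hilbert_space "S ` N_perp" L2_inner
    rewrites "semi_inner_function_space.nrm L2_inner = L2_norm"
  proof -
    show "function_Hilbert_space (S ` N_perp) L2_inner"
    proof
      show "(\<lambda>t. 0) \<in> S ` N_perp" using S_zero N_perp_zero by (metis imageI)
      show "(\<lambda>t. u t + v t) \<in> S ` N_perp" if uv: "u \<in> S ` N_perp" "v \<in> S ` N_perp" for u v
      proof -
        obtain c d where cd: "c \<in> N_perp" "d \<in> N_perp" "u = S c" "v = S d" using uv by blast
        show ?thesis unfolding cd S_add[OF N_perp_ell2[OF cd(1)] N_perp_ell2[OF cd(2)], symmetric]
          by (intro imageI N_perp_add cd)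
      qed
      show "(\<lambda>t. a * u t) \<in> S ` N_perp" if u: "u \<in> S ` N_perp" for a u
      proof -
        obtain d where d: "d \<in> N_perp" "u = S d" using u by blast
        show ?thesis unfolding d S_scale[symmetric] by (intro imageI N_perp_scale d)
      qed
      show "u = (\<lambda>t. 0)" if u: "u \<in> S ` N_perp" "L2_inner u u = 0" for u
      proof -
        obtain d where d: "d \<in> N_perp" "u = S d" using u by blast
        have "L2_norm u = 0" using u(2) L2.ip_self[OF W[OF d(1)]] d(2) by simp
        then have "AE t in lebesgue. S d t = S (\<lambda>n. 0) t"
          using L2_norm_eq_0_iff_AE[OF W[OF d(1)]] d(2) S_zero by simp
        then have "d = (\<lambda>n. 0)" by (rule S_inj_on_N_perp[OF d(1) N_perp_zero])
        then show ?thesis using d(2) S_zero by simp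
      qed
      fix s :: "nat \<Rightarrow> real \<Rightarrow> complex"
      assume s: "\<And>n. s n \<in> S ` N_perp"
        and cauchy: "\<forall>e>0. \<exists>M. \<forall>m\<ge>M. \<forall>n\<ge>M. sqrt (Re (L2_inner (\<lambda>x. s m x - s n x) (\<lambda>x. s m x - s n x))) < e"
      have "\<exists>d. d \<in> N_perp \<and> s k = S d" for k using s[of k] by blast
      then obtain d where d: "\<And>k. d k \<in> N_perp" and sd: "\<And>k. s k = S (d k)" by metis
      have nrm: "sqrt (Re (L2_inner u u)) = L2_norm u" for u by (simp add: L2_inner_self L2_norm_def)
      have "\<exists>e\<in>ell2. (\<lambda>k. ell2_norm (\<lambda>n. d k n - e n)) \<longlonglongrightarrow> 0"
      proof (rule ell2_complete[OF N_perp_ell2[OF d]])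
        fix e :: real assume "e > 0"
        then have "sqrt A * e > 0" using A_pos by simp
        then obtain M where M: "\<And>j k. j \<ge> M \<Longrightarrow> k \<ge> M \<Longrightarrow> L2_norm (\<lambda>x. s j x - s k x) < sqrt A * e"
          using cauchy unfolding nrm by blast
        have "sqrt A * ell2_norm (\<lambda>n. d j n - d k n) < sqrt A * e" if "j \<ge> M" "k \<ge> M" for j k
          using S_lower_bound_on_N_perp[OF N_perp_diff[OF d d], of j k] M[OF that]
          by (simp add: S_diff[OF N_perp_ell2[OF d] N_perp_ell2[OF d]] sd)
        then show "\<exists>N. \<forall>j\<ge>N. \<forall>k\<ge>N. ell2_norm (\<lambda>n. d j n - d k n) < e"
          using A_pos by (intro exI[of _ M]) simp
      qed
      then obtain e where e: "e \<in> ell2" and lim: "(\<lambda>k. ell2_norm (\<lambda>n. d k n - e n)) \<longlonglongrightarrow> 0" by blast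
      have "e \<in> N_perp" by (rule N_perp_closed[OF d e lim])
      moreover have "(\<lambda>k. L2_norm (\<lambda>x. s k x - S e x)) \<longlonglongrightarrow> 0"
      proof (rule Lim_null_comparison)
        show "(\<lambda>k. sqrt B * ell2_norm (\<lambda>n. d k n - e n)) \<longlonglongrightarrow> 0" by (intro tendsto_mult_right_zero lim)
        show "\<forall>\<^sub>F k in sequentially. norm (L2_norm (\<lambda>t. s k t - S e t)) \<le> sqrt B * ell2_norm (\<lambda>n. d k n - e n)"
          using S_bounded(2)[OF ell2.diff[OF N_perp_ell2[OF d] e]]
          by (simp add: S_diff[OF N_perp_ell2[OF d] e] sd L2_norm_def)
      qed
      ultimately show "\<exists>f\<in>S ` N_perp. (\<lambda>n. sqrt (Re (L2_inner (\<lambda>x. s n x - f x) (\<lambda>x. s n x - f x)))) \<longlonglongrightarrow> 0"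
        unfolding nrm by (intro bexI[of _ "S e"] imageI)
    qed (auto intro: W L2.ip_add L2.ip_scale L2.ip_commute L2.ip_nonneg)
    show "semi_inner_function_space.nrm L2_inner = L2_norm" by (rule nrm_L2)
  qed
  show ?thesis
  proof (rule W.bounded_evaluations_imp_reproducing_kernel)
    fix t
    have "cmod (S d t) \<le> (ell2_norm (\<lambda>n. g n t) / sqrt A) * L2_norm (S d)" if d: "d \<in> N_perp" for d
    proof -
      have "ell2_norm d \<le> L2_norm (S d) / sqrt A"
        using S_lower_bound_on_N_perp[OF d] A_pos by (simp add: le_divide_eq mult.commute)
      then have "ell2_norm d * ell2_norm (\<lambda>n. g n t) \<le> L2_norm (S d) / sqrt A * ell2_norm (\<lambda>n. g n t)"
        by (rule mult_right_mono[OF _ ell2.nrm_nonneg[OF pointwise]])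
      with cmod_synthesis_le[where g = g and t = t, OF N_perp_ell2[OF d] pointwise]
      have "cmod (S d t) \<le> L2_norm (S d) / sqrt A * ell2_norm (\<lambda>n. g n t)" by (rule order_trans)
      then show ?thesis by (simp add: mult.commute)
    qed
    then show "\<exists>K. \<forall>f\<in>S ` N_perp. cmod (f t) \<le> K * L2_norm f"
      by (intro exI[of _ "ell2_norm (\<lambda>n. g n t) / sqrt A"]) auto
  qed
qed

end

section \<open>Uniform convergence, continuity and rescaling\<close>

lemma L2_has_sum_unique:
  assumes "L2_has_sum u f" "L2_has_sum u h"
  shows "AE t in lebesgue. f t = h t"
proof -
  have u: "\<And>n. u n \<in> L2" and f: "f \<in> L2" and h: "h \<in> L2"
    and lim: "((\<lambda>F. L2_norm (\<lambda>t. (\<Sum>n\<in>F. u n t) - f t)) \<longlongrightarrow> 0) (finite_subsets_at_top UNIV)"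
      "((\<lambda>F. L2_norm (\<lambda>t. (\<Sum>n\<in>F. u n t) - h t)) \<longlongrightarrow> 0) (finite_subsets_at_top UNIV)"
    using assms by (simp_all add: L2_has_sum_def)
  have p: "(\<lambda>t. \<Sum>n\<in>F. u n t) \<in> L2" for F
    using L2.sum_closed[of F u "\<lambda>_. 1"] u by simp
  have "L2_norm (\<lambda>t. f t - h t) \<le> 0 + 0"
  proof (rule tendsto_lowerbound[OF tendsto_add[OF lim]])
    show "\<forall>\<^sub>F F in finite_subsets_at_top UNIV. L2_norm (\<lambda>t. f t - h t) \<le>
        L2_norm (\<lambda>t. (\<Sum>n\<in>F. u n t) - f t) + L2_norm (\<lambda>t. (\<Sum>n\<in>F. u n t) - h t)"
      using L2.nrm_triangle_diff[OF f p h] by (simp add: L2.nrm_minus_commute[OF p f])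
  qed simp
  then have "L2_norm (\<lambda>t. f t - h t) = 0" using L2.nrm_nonneg[OF L2.diff[OF f h]] by simp
  then show ?thesis by (simp add: L2_norm_diff_eq_0_iff_AE[OF f h])
qed

lemma synthesis_uniform_limit:
  assumes d: "d \<in> ell2" and g: "\<And>t. (\<lambda>n. g n t) \<in> ell2" and M: "\<And>t. ell2_norm (\<lambda>n. g n t) \<le> M"
  shows "uniform_limit UNIV (\<lambda>F t. \<Sum>n\<in>F. d n * g n t) (synthesis g d) (finite_subsets_at_top UNIV)"
proof (rule uniform_limitI)
  fix e :: real assume e: "e > 0"
  have M0: "0 \<le> M" using ell2.nrm_nonneg[OF g] M order_trans by blast
  have "((\<lambda>F. ell2_norm (tail d F) * M) \<longlongrightarrow> 0) (finite_subsets_at_top UNIV)"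
    by (intro tendsto_mult_left_zero ell2_norm_tail_tendsto d)
  moreover have "\<forall>\<^sub>F F in finite_subsets_at_top UNIV. finite (F :: int set)"
    unfolding eventually_finite_subsets_at_top by (intro exI[of _ "{}"]) simp
  ultimately have "\<forall>\<^sub>F F in finite_subsets_at_top UNIV. ell2_norm (tail d F) * M < e \<and> finite F"
    using e by (intro eventually_conj) (auto dest: order_tendstoD(2))
  then
  show "\<forall>\<^sub>F F in finite_subsets_at_top UNIV. \<forall>t\<in>UNIV. dist (\<Sum>n\<in>F. d n * g n t) (synthesis g d t) < e"
  proof eventually_elim
    case (elim F)
    then have elim: "ell2_norm (tail d F) * M < e" "finite F" by auto
    show ?case
    proof
      fix t
      have "dist (\<Sum>n\<in>F. d n * g n t) (synthesis g d t) = cmod (synthesis g (tail d F) t)"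
        unfolding synthesis_tail[where g = g and t = t, OF d elim(2) g] by (simp add: dist_norm norm_minus_commute)
      also have "\<dots> \<le> ell2_norm (tail d F) * ell2_norm (\<lambda>n. g n t)"
        by (rule cmod_synthesis_le[where g = g, OF tail_ell2[OF d] g])
      also have "\<dots> \<le> ell2_norm (tail d F) * M"
        by (rule mult_left_mono[OF M ell2.nrm_nonneg[OF tail_ell2[OF d]]])
      finally show "dist (\<Sum>n\<in>F. d n * g n t) (synthesis g d t) < e" using elim(1) by simp
    qed
  qed
qed

lemma synthesis_continuous:
  assumes "d \<in> ell2" "\<And>t. (\<lambda>n. g n t) \<in> ell2" "\<And>t. ell2_norm (\<lambda>n. g n t) \<le> M"
    and cont: "\<And>n. continuous_on UNIV (g n)"
  shows "continuous_on UNIV (synthesis g d)"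
proof (rule uniform_limit_theorem[OF _ synthesis_uniform_limit[OF assms(1-3)]])
  show "\<forall>\<^sub>F F in finite_subsets_at_top UNIV. continuous_on UNIV (\<lambda>t. \<Sum>n\<in>F. d n * g n t)"
    by (intro always_eventually allI continuous_intros cont)
qed simp

text \<open>The set where the functions differ is open, and a nonempty open set contains a box, which is
not negligible.\<close>

lemma continuous_AE_eq_imp_eq:
  fixes f h :: "real \<Rightarrow> complex"
  assumes "continuous_on UNIV f" "continuous_on UNIV h" and ae: "AE t in lebesgue. f t = h t"
  shows "f = h"
proof (rule ccontr)
  define U where "U = {t. f t \<noteq> h t}"
  assume "f \<noteq> h"
  then obtain t where t: "t \<in> U" by (auto simp: U_def)
  have "open U" unfolding U_def using assms by (intro open_Collect_neq)
  then obtain a b where ab: "t \<in> box a b" "cbox a b \<subseteq> U" using t by (rule open_contains_cbox) blast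
  have "negligible U"
    using ae unfolding U_def eventually_ae_filter_negligible by (blast intro: negligible_subset)
  then have "negligible (box a b)" by (rule negligible_subset) (use ab(2) box_subset_cbox in blast)
  then have "box a b = {}" by (simp only: negligible_interval)
  then show False using ab by blast
qed

lemma closed_span_rescale_subset:
  assumes "\<And>n. u n \<noteq> 0"
  shows "L2_closed_span g \<subseteq> L2_closed_span (\<lambda>n t. u n * g n t)"
proof
  fix f assume f: "f \<in> L2_closed_span g"
  have "\<exists>F a. finite F \<and> L2_norm (\<lambda>t. f t - (\<Sum>n\<in>F. a n * (u n * g n t))) < e" if e: "e > 0" for e
  proof -
    obtain F a where "finite F" "L2_norm (\<lambda>t. f t - (\<Sum>n\<in>F. a n * g n t)) < e"
      using f e unfolding L2_closed_span_def by blast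
    then show ?thesis
      using assms by (intro exI[of _ F] exI[of _ "\<lambda>n. a n / u n"]) simp
  qed
  then show "f \<in> L2_closed_span (\<lambda>n t. u n * g n t)" using f by (simp add: L2_closed_span_def)
qed

lemma closed_span_rescale:
  assumes "\<And>n. u n \<noteq> 0"
  shows "L2_closed_span (\<lambda>n t. u n * g n t) = L2_closed_span g"
  using closed_span_rescale_subset[of u g] closed_span_rescale_subset[of "\<lambda>n. 1 / u n" "\<lambda>n t. u n * g n t"]
  by (simp add: assms)

lemma ell2_unimodular:
  assumes "\<And>n. cmod (u n) = 1"
  shows "(\<lambda>n. u n * d n) \<in> ell2 \<longleftrightarrow> d \<in> ell2" and "ell2_norm (\<lambda>n. u n * d n) = ell2_norm d"
  by (simp_all add: ell2_def ell2_norm_def norm_mult assms)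

lemma is_frame_unimodular:
  assumes u: "\<And>n. cmod (u n) = 1" and frame: "is_frame g (L2_closed_span g)"
  shows "is_frame (\<lambda>n t. u n * g n t) (L2_closed_span (\<lambda>n t. u n * g n t))"
proof -
  have u0: "u n \<noteq> 0" for n using u[of n] by auto
  have span: "\<And>n. g n \<in> L2_closed_span g" using frame by (simp add: is_frame_def)
  then have g: "\<And>n. g n \<in> L2" by (blast intro: L2_closed_span_L2)
  have an: "analysis (\<lambda>n t. u n * g n t) h = (\<lambda>n. cnj (u n) * analysis g h n)" if "h \<in> L2_closed_span g" for h
    by (simp add: analysis_def fun_eq_iff L2.ip_scale_right[OF g L2_closed_span_L2[OF that]])
  have cu: "cmod (cnj (u n)) = 1" for n by (simp add: u)
  show ?thesis
    using frame closed_span_scale[OF g span]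
    unfolding closed_span_rescale[OF u0] is_frame_iff
    by (simp add: an ell2_unimodular[OF cu] cong: ball_cong)
qed

lemma is_frame_imp_pointwise_frame:
  assumes "is_frame g (L2_closed_span g)" "\<And>t. (\<lambda>n. g n t) \<in> ell2"
  shows "\<exists>A B. pointwise_frame g A B"
  using assms unfolding is_frame_iff pointwise_frame_def by blast

context pointwise_frame
begin

text \<open>A sequence in \<open>N\<close> synthesizes the zero class, so the lower Riesz bound makes it zero.\<close>

lemma Riesz_basis_imp_N_perp_eq_ell2:
  assumes "\<And>c. c \<in> ell2 \<Longrightarrow> \<exists>f. L2_has_sum (\<lambda>n t. c n * g n t) f \<and> a * (ell2_norm c)\<^sup>2 \<le> (L2_norm f)\<^sup>2"
    and "a > 0"
  shows "N_perp = ell2"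
proof -
  have "d = (\<lambda>n. 0)" if d: "d \<in> N" for d
  proof -
    have d2: "d \<in> ell2" using d by (rule N_ell2)
    obtain f where f: "L2_has_sum (\<lambda>n t. d n * g n t) f" "a * (ell2_norm d)\<^sup>2 \<le> (L2_norm f)\<^sup>2"
      using assms(1)[OF d2] by blast
    have fL: "f \<in> L2" using f by (simp add: L2_has_sum_def)
    have "AE t in lebesgue. S d t = 0" using d by (simp add: N_def)
    with L2_has_sum_unique[OF f(1) S_L2_has_sum[OF d2]] have "AE t in lebesgue. f t = 0"
      by eventually_elim simp
    then have "L2_norm f = 0" by (simp add: L2_norm_eq_0_iff_AE[OF fL])
    then have "ell2_norm d = 0" using f(2) \<open>a > 0\<close> by (simp add: mult_le_0_iff)
    then show ?thesis by (rule ell2_norm_eq_0[OF d2])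
  qed
  then have N_zero: "\<And>d. d \<in> N \<Longrightarrow> d = (\<lambda>n. 0)" .
  have "c \<in> N_perp" if "c \<in> ell2" for c
  proof (rule N_perp_I[OF that])
    fix d assume "d \<in> N"
    then have "d = (\<lambda>n. 0)" by (rule N_zero)
    then show "ell2_inner c d = 0" by (simp add: ell2_inner_def)
  qed
  then show ?thesis using N_perp_ell2 by blast
qed

text \<open>The class of \<open>S d\<close> is also represented by \<open>S e\<close> with \<open>e \<in> N\<^sup>\<bottom>\<close>, and continuity upgrades
equality almost everywhere to equality.\<close>

lemma continuous_imp_S_image_N_perp:
  assumes "\<And>d. d \<in> ell2 \<Longrightarrow> continuous_on UNIV (S d)"
  shows "S ` N_perp = S ` ell2"
proof
  show "S ` N_perp \<subseteq> S ` ell2" using N_perp_ell2 by blast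
  show "S ` ell2 \<subseteq> S ` N_perp"
  proof
    fix f assume "f \<in> S ` ell2"
    then obtain d where d: "d \<in> ell2" "f = S d" by blast
    obtain e where e: "e \<in> N_perp" "AE t in lebesgue. S d t = S e t"
      using exists_N_perp_coefficients[OF S_in_V[OF d(1)]] by blast
    have "S d = S e" by (rule continuous_AE_eq_imp_eq[OF assms assms e(2)]) (use d e N_perp_ell2 in auto)
    then show "f \<in> S ` N_perp" using d e by blast
  qed
qed

end

text \<open>This extracts square-summability from \<open>C\<close>, which is a sum of extended nonnegative numbers.\<close>

lemma ennreal_infsum_le_imp_ell2:
  assumes "(\<Sum>\<^sub>\<infinity>n. ennreal ((cmod (v n))\<^sup>2)) \<le> ennreal M" "0 \<le> M"
  shows "v \<in> ell2" "ell2_norm v \<le> sqrt M"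
proof -
  have "(\<Sum>n\<in>F. (cmod (v n))\<^sup>2) \<le> (sqrt M)\<^sup>2" if "finite F" for F
  proof -
    have "ennreal (\<Sum>n\<in>F. (cmod (v n))\<^sup>2) = (\<Sum>n\<in>F. ennreal ((cmod (v n))\<^sup>2))" by (simp add: sum_ennreal)
    also have "\<dots> = (\<Sum>\<^sub>\<infinity>n\<in>F. ennreal ((cmod (v n))\<^sup>2))" using that by simp
    also have "\<dots> \<le> (\<Sum>\<^sub>\<infinity>n. ennreal ((cmod (v n))\<^sup>2))"
      by (rule infsum_mono_neutral) (auto intro: nonneg_summable_on_complete)
    also have "\<dots> \<le> ennreal M" by (fact assms)
    finally show ?thesis using assms(2) by simp
  qed
  with assms(2) show "v \<in> ell2" "ell2_norm v \<le> sqrt M"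
    using ell2_I_bounded[where c = v and M = "sqrt M"] by (simp_all del: real_sqrt_pow2)
qed

section \<open>Chirp-modulated shifts\<close>

text \<open>The chirp factor of the coefficients is moved to the generators. This turns the fractional
convolution into a plain synthesis operator and its kernel into \<open>N\<close>, with no change of norms.\<close>

definition chirp_gen :: "real \<Rightarrow> (real \<Rightarrow> complex) \<Rightarrow> int \<Rightarrow> real \<Rightarrow> complex" where
  "chirp_gen \<theta> \<phi> n t = chirp \<theta> (of_int n) * shift_gen \<theta> \<phi> n t"

lemma cmod_chirp [simp]: "cmod (chirp \<theta> x) = 1"
  by (simp add: chirp_def)

lemma chirp_nonzero: "chirp \<theta> x \<noteq> 0"
  by (simp add: chirp_def)

lemma continuous_chirp: "continuous_on UNIV (chirp \<theta>)"
  unfolding chirp_def by (intro continuous_intros)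

lemma frac_conv_eq_synthesis: "frac_conv \<theta> \<phi> = synthesis (chirp_gen \<theta> \<phi>)"
proof (intro ext)
  fix c t
  show "frac_conv \<theta> \<phi> c t = synthesis (chirp_gen \<theta> \<phi>) c t"
    unfolding frac_conv_def synthesis_def infsum_cmult_right'[symmetric]
    by (rule infsum_cong) (simp add: chirp_gen_def shift_gen_def chirp_seq_def)
qed

lemma frac_conv_term_eq: "frac_conv_term \<theta> \<phi> c = (\<lambda>n t. c n * chirp_gen \<theta> \<phi> n t)"
  by (simp add: frac_conv_term_def chirp_gen_def shift_gen_def chirp_seq_def fun_eq_iff)

lemma closed_span_chirp_gen: "L2_closed_span (chirp_gen \<theta> \<phi>) = V_space \<theta> \<phi>"
  unfolding chirp_gen_def V_space_def by (rule closed_span_rescale[OF chirp_nonzero])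

lemma chirp_gen_ell2:
  assumes "C_sum \<theta> \<phi> t \<le> ennreal M" "0 \<le> M"
  shows "(\<lambda>n. chirp_gen \<theta> \<phi> n t) \<in> ell2"
    and "ell2_norm (\<lambda>n. chirp_gen \<theta> \<phi> n t) \<le> cmod (chirp_const \<theta>) * sqrt M"
proof -
  let ?v = "\<lambda>n::int. chirp_fun \<theta> \<phi> (t - of_int n)"
  have v: "?v \<in> ell2" "ell2_norm ?v \<le> sqrt M"
    using ennreal_infsum_le_imp_ell2[of ?v M] assms by (simp_all add: C_sum_def)
  have eq: "(\<lambda>n. chirp_gen \<theta> \<phi> n t) = (\<lambda>n. chirp \<theta> (of_int n) * (chirp_eta \<theta> t * ?v n))"
    by (simp add: chirp_gen_def shift_gen_def)
  show "(\<lambda>n. chirp_gen \<theta> \<phi> n t) \<in> ell2"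
    unfolding eq by (subst ell2_unimodular(1)) (simp_all add: ell2_scale v)
  have "ell2_norm (\<lambda>n. chirp_gen \<theta> \<phi> n t) = cmod (chirp_const \<theta>) * ell2_norm ?v"
    unfolding eq by (subst ell2_unimodular(2)) (simp_all add: ell2.nrm_scale v chirp_eta_def norm_mult)
  then show "ell2_norm (\<lambda>n. chirp_gen \<theta> \<phi> n t) \<le> cmod (chirp_const \<theta>) * sqrt M"
    using v(2) by (simp add: mult_left_mono)
qed

lemma continuous_chirp_gen:
  assumes "continuous_on UNIV (chirp_fun \<theta> \<phi>)"
  shows "continuous_on UNIV (chirp_gen \<theta> \<phi> n)"
  unfolding chirp_gen_def shift_gen_def chirp_eta_def
  by (intro continuous_intros continuous_chirp continuous_on_compose2[OF assms]) auto

theorem proposition3p1: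
  fixes \<theta> :: real and \<phi> :: "real \<Rightarrow> complex"
  assumes theta: "\<forall>k::int. \<theta> \<noteq> of_int k * pi"
    and phi: "\<phi> \<in> L2"
    and C_finite: "\<forall>t. C_sum \<theta> \<phi> t < \<infinity>"
  shows
    "(is_frame (shift_gen \<theta> \<phi>) (V_space \<theta> \<phi>) \<longrightarrow>
        reproducing_kernel_Hilbert_space (Vp_space \<theta> \<phi>) L2_inner \<and>
        (\<forall>c \<in> ell2_orthogonal (T_kernel \<theta> \<phi>).
          (\<forall>t. ((\<lambda>n. frac_conv_term \<theta> \<phi> c n t) has_sum frac_conv \<theta> \<phi> c t) UNIV) \<and>
          L2_has_sum (frac_conv_term \<theta> \<phi> c) (frac_conv \<theta> \<phi> c)))
   \<and> (is_Riesz_basis (shift_gen \<theta> \<phi>) (V_space \<theta> \<phi>) \<longrightarrow>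
        represents_classes (V_pointwise \<theta> \<phi>) (V_space \<theta> \<phi>) \<and>
        reproducing_kernel_Hilbert_space (V_pointwise \<theta> \<phi>) L2_inner \<and>
        (\<forall>c \<in> ell2.
          (\<forall>t. ((\<lambda>n. frac_conv_term \<theta> \<phi> c n t) has_sum frac_conv \<theta> \<phi> c t) UNIV) \<and>
          L2_has_sum (frac_conv_term \<theta> \<phi> c) (frac_conv \<theta> \<phi> c)))
   \<and> (is_frame (shift_gen \<theta> \<phi>) (V_space \<theta> \<phi>) \<and>
      continuous_on UNIV (chirp_fun \<theta> \<phi>) \<and>
      (SUP t. C_sum \<theta> \<phi> t) < \<infinity> \<longrightarrow>
        represents_classes (V_pointwise \<theta> \<phi>) (V_space \<theta> \<phi>) \<and>
        reproducing_kernel_Hilbert_space (V_pointwise \<theta> \<phi>) L2_inner \<and>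
        (\<forall>c \<in> ell2.
          (\<forall>t. ((\<lambda>n. frac_conv_term \<theta> \<phi> c n t) has_sum frac_conv \<theta> \<phi> c t) UNIV) \<and>
          L2_has_sum (frac_conv_term \<theta> \<phi> c) (frac_conv \<theta> \<phi> c) \<and>
          uniform_limit UNIV (\<lambda>F t. \<Sum>n\<in>F. frac_conv_term \<theta> \<phi> c n t)
            (frac_conv \<theta> \<phi> c) (finite_subsets_at_top UNIV) \<and>
          continuous_on UNIV (frac_conv \<theta> \<phi> c)) \<and>
        V_pointwise \<theta> \<phi> \<subseteq> {f. continuous_on UNIV f} \<inter> L2)"
proof -
  let ?g = "chirp_gen \<theta> \<phi>"
  have pointwise: "(\<lambda>n. ?g n t) \<in> ell2" for t
  proof -
    obtain M where "0 \<le> M" "C_sum \<theta> \<phi> t = ennreal M"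
      using C_finite[rule_format, of t] by (cases "C_sum \<theta> \<phi> t") auto
    then show ?thesis by (intro chirp_gen_ell2(1)) auto
  qed
  have frame: "\<exists>A B. pointwise_frame ?g A B" if "is_frame (shift_gen \<theta> \<phi>) (V_space \<theta> \<phi>)"
  proof (rule is_frame_imp_pointwise_frame[OF _ pointwise])
    show "is_frame ?g (L2_closed_span ?g)"
      unfolding chirp_gen_def using that unfolding V_space_def by (intro is_frame_unimodular) simp_all
  qed
  have convergence: "(\<forall>t. ((\<lambda>n. frac_conv_term \<theta> \<phi> c n t) has_sum frac_conv \<theta> \<phi> c t) UNIV) \<and>
      L2_has_sum (frac_conv_term \<theta> \<phi> c) (frac_conv \<theta> \<phi> c)"
    if "pointwise_frame ?g A B" "c \<in> ell2" for A B c
    unfolding frac_conv_term_eq frac_conv_eq_synthesis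
    using pointwise_frame.S_L2_has_sum[OF that] synthesis_has_sum[where g = ?g, OF that(2) pointwise] by blast
  have kernel: "ell2_orthogonal (T_kernel \<theta> \<phi>) = pointwise_frame.N_perp ?g" if "pointwise_frame ?g A B" for A B
    unfolding pointwise_frame.N_perp_def[OF that] pointwise_frame.N_def[OF that] T_kernel_def frac_conv_eq_synthesis ..
  show ?thesis
  proof (intro conjI impI)
    assume "is_frame (shift_gen \<theta> \<phi>) (V_space \<theta> \<phi>)"
    then obtain A B where F: "pointwise_frame ?g A B" using frame by blast
    interpret pointwise_frame ?g A B by (fact F)
    show "reproducing_kernel_Hilbert_space (Vp_space \<theta> \<phi>) L2_inner"
      unfolding Vp_space_def kernel[OF F] frac_conv_eq_synthesis by (rule reproducing_kernel)
    show "\<forall>c \<in> ell2_orthogonal (T_kernel \<theta> \<phi>).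
          (\<forall>t. ((\<lambda>n. frac_conv_term \<theta> \<phi> c n t) has_sum frac_conv \<theta> \<phi> c t) UNIV) \<and>
          L2_has_sum (frac_conv_term \<theta> \<phi> c) (frac_conv \<theta> \<phi> c)"
      unfolding kernel[OF F] using convergence[OF F N_perp_ell2] by blast
  next
    assume Riesz: "is_Riesz_basis (shift_gen \<theta> \<phi>) (V_space \<theta> \<phi>)"
    then obtain A B where F: "pointwise_frame ?g A B"
      using frame Riesz_basis_imp_frame unfolding V_space_def by blast
    interpret pointwise_frame ?g A B by (fact F)
    obtain a where a: "a > 0" and
      lower: "\<And>c. c \<in> ell2 \<Longrightarrow> \<exists>f. L2_has_sum (\<lambda>n t. c n * shift_gen \<theta> \<phi> n t) f \<and> a * (ell2_norm c)\<^sup>2 \<le> (L2_norm f)\<^sup>2"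
      using Riesz unfolding is_Riesz_basis_def by blast
    have "N_perp = ell2"
    proof (rule Riesz_basis_imp_N_perp_eq_ell2[OF _ a])
      fix c assume "c \<in> ell2"
      then have "(\<lambda>n. chirp \<theta> (of_int n) * c n) \<in> ell2" by (simp add: ell2_unimodular)
      from lower[OF this, unfolded ell2_unimodular(2)[of "\<lambda>n. chirp \<theta> (of_int n)", OF cmod_chirp]] show "\<exists>f. L2_has_sum (\<lambda>n t. c n * ?g n t) f \<and> a * (ell2_norm c)\<^sup>2 \<le> (L2_norm f)\<^sup>2"
        by (simp add: chirp_gen_def mult_ac)
    qed
    then have eq: "V_pointwise \<theta> \<phi> = S ` N_perp" by (simp add: V_pointwise_def frac_conv_eq_synthesis)
    show "represents_classes (V_pointwise \<theta> \<phi>) (V_space \<theta> \<phi>)"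
      unfolding eq closed_span_chirp_gen[symmetric] by (rule represents_V)
    show "reproducing_kernel_Hilbert_space (V_pointwise \<theta> \<phi>) L2_inner"
      unfolding eq by (rule reproducing_kernel)
    show "\<forall>c \<in> ell2. (\<forall>t. ((\<lambda>n. frac_conv_term \<theta> \<phi> c n t) has_sum frac_conv \<theta> \<phi> c t) UNIV) \<and>
          L2_has_sum (frac_conv_term \<theta> \<phi> c) (frac_conv \<theta> \<phi> c)"
      using convergence[OF F] by blast
  next
    assume asm: "is_frame (shift_gen \<theta> \<phi>) (V_space \<theta> \<phi>) \<and> continuous_on UNIV (chirp_fun \<theta> \<phi>) \<and>
      (SUP t. C_sum \<theta> \<phi> t) < \<infinity>"
    then obtain A B where F: "pointwise_frame ?g A B" using frame by blast
    interpret pointwise_frame ?g A B by (fact F)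
    obtain M where M: "0 \<le> M" "(SUP t. C_sum \<theta> \<phi> t) = ennreal M"
      using asm by (cases "SUP t. C_sum \<theta> \<phi> t") auto
    have "C_sum \<theta> \<phi> t \<le> ennreal M" for t unfolding M(2)[symmetric] by (rule SUP_upper) simp
    note bounded = chirp_gen_ell2(2)[OF this M(1)]
    have cont: "continuous_on UNIV (S c)" if "c \<in> ell2" for c
      using asm by (intro synthesis_continuous[OF that pointwise bounded] continuous_chirp_gen) simp
    have eq: "V_pointwise \<theta> \<phi> = S ` N_perp"
      using continuous_imp_S_image_N_perp[OF cont] by (simp add: V_pointwise_def frac_conv_eq_synthesis)
    show "represents_classes (V_pointwise \<theta> \<phi>) (V_space \<theta> \<phi>)"
      unfolding eq closed_span_chirp_gen[symmetric] by (rule represents_V)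
    show "reproducing_kernel_Hilbert_space (V_pointwise \<theta> \<phi>) L2_inner"
      unfolding eq by (rule reproducing_kernel)
    have uniform: "uniform_limit UNIV (\<lambda>F t. \<Sum>n\<in>F. frac_conv_term \<theta> \<phi> c n t)
            (frac_conv \<theta> \<phi> c) (finite_subsets_at_top UNIV)" if "c \<in> ell2" for c
      unfolding frac_conv_term_eq frac_conv_eq_synthesis
      by (rule synthesis_uniform_limit[OF that pointwise bounded])
    show "\<forall>c \<in> ell2.
          (\<forall>t. ((\<lambda>n. frac_conv_term \<theta> \<phi> c n t) has_sum frac_conv \<theta> \<phi> c t) UNIV) \<and>
          L2_has_sum (frac_conv_term \<theta> \<phi> c) (frac_conv \<theta> \<phi> c) \<and>
          uniform_limit UNIV (\<lambda>F t. \<Sum>n\<in>F. frac_conv_term \<theta> \<phi> c n t)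
            (frac_conv \<theta> \<phi> c) (finite_subsets_at_top UNIV) \<and>
          continuous_on UNIV (frac_conv \<theta> \<phi> c)"
      using convergence[OF F] uniform cont unfolding frac_conv_eq_synthesis by blast
    show "V_pointwise \<theta> \<phi> \<subseteq> {f. continuous_on UNIV f} \<inter> L2"
      unfolding V_pointwise_def frac_conv_eq_synthesis using cont S_bounded(1) by blast
  qed
qed

end
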